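(* Let $\hat{\Sigma}_x\in\mathbb{C}^{L\times L}$ be a Hermitian positive semidefinite matrix of rank $r$, let $X=\hat{\Sigma}_x\odot\operatorname{Circulant}\{[1,e^{\imath\varphi_1},\ldots,e^{\imath\varphi_{L-1}}]\}$ for some angles $\varphi_1,\ldots,\varphi_{L-1}\in[0,2\pi)$, and for angles $\widetilde{\varphi}_1,\ldots,\widetilde{\varphi}_{L-1}$ let $\widetilde{X}=X\odot\operatorname{Circulant}\{[1,e^{-\imath\widetilde{\varphi}_1},\ldots,e^{-\imath\widetilde{\varphi}_{L-1}}]\}$. Suppose that $r<\sqrt{L}$ and that the second-smallest singular value of the matrix $W$ (constructed from $X$ as described in the context) is strictly positive. Then a matrix $\widetilde{X}$ of this form is Hermitian and positive semidefinite if and only if $\widetilde{X}\in\Omega(\hat{\Sigma}_x)$. Moreover, let $\mathcal{V}\in\mathbb{C}^{L+r^4L}$ be a right singular vector of $W$ corresponding to its smallest singular value. If, for any fixed $k\in\{0,\ldots,L-1\}$, $$\widetilde{\varphi}_m\equiv-\sum_{\ell=1}^m\arg\{\mathcal{V}[\ell]\}+\frac{m}{L}\sum_{\ell=0}^{L-1}\arg\{\mathcal{V}[\ell]\}+\frac{2\pi km}{L}\pmod{2\pi},\qquad m=1,\ldots,L-1,$$ then there is $k'\in\{0,\ldots,L-1\}$ such that $$\widetilde{\varphi}_m\equiv\varphi_m+\frac{2\pi k'm}{L}\pmod{2\pi},\qquad m=1,\ldots,L-1,$$ and consequently $\widetilde{X}\in\Omega(\hat{\Sigma}_x)$.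
   Context: All indices are in $\{0,\ldots,L-1\}$ and are taken modulo $L$ (the entries of $\mathcal{V}$ are indexed from $0$). $\overline{(\cdot)}$ is complex conjugation, $(\cdot)^*$ is conjugate transpose, $\odot$ is the entrywise product, $\otimes$ is the Kronecker product, $\arg$ is the argument of a complex number, $\operatorname{Circulant}\{z\}[k_1,k_2]=z[\operatorname{mod}(k_2-k_1,L)]$ for $z\in\mathbb{C}^L$, $f_\ell\in\mathbb{C}^L$ is given by $f_\ell[k]=e^{-\imath2\pi k\ell/L}$, and $\Omega(\hat{\Sigma}_x)=\{\operatorname{diag}(f_\ell)\,\hat{\Sigma}_x\,\operatorname{diag}(f_\ell^* ):\ \ell=0,\ldots,L-1\}$. Construction of $W$ (for $r<\sqrt{L}$) from $X$. Let $R_{i,j}\{X\}[k,m]=X[k-i,m-j]$ and $H_{i,j}=X\odot\overline{R_{i,j}\{X\}}$. The matrix $H_{i,i}$ equals $\hat{\Sigma}_x\odot\overline{R_{i,i}\{\hat{\Sigma}_x\}}$ and is Hermitian positive semidefinite of rank at most $r^2$; let $V^{(i)}\in\mathbb{C}^{L\times r^2}$ have as columns $r^2$ orthonormal eigenvectors of $H_{i,i}$ corresponding to its $r^2$ largest eigenvalues. With $\mathbf{e}_m$ the $m$-th standard basis vector and $\operatorname{vec}$ the column-stacking operation, set $Z^{(i)}=\overline{V^{(i+1)}}\otimes V^{(i)}\in\mathbb{C}^{L^2\times r^4}$ and $M^{(i)}_m=\operatorname{vec}\{H_{i,i+1}\}\odot\operatorname{vec}\{\operatorname{Circulant}\{\mathbf{e}_m\}\}\in\mathbb{C}^{L^2}$.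 Then $W=[\,M\;\;-\operatorname{BlockDiag}\{Z^{(0)},\ldots,Z^{(L-1)}\}\,]\in\mathbb{C}^{L^3\times(L+r^4L)}$, where $M\in\mathbb{C}^{L^3\times L}$ has $M^{(i)}_m$ as its block in block row $i$ and column $m$. Singular values are counted with multiplicity. *)

theory Defs
  imports
    "HOL-Library.Real_Mod"
    "Jordan_Normal_Form.Schur_Decomposition"
    "Jordan_Normal_Form.DL_Rank"
begin

text \<open>
  Matrices and vectors are those of Jordan-Normal-Form and are indexed from 0. Indices of
  \<open>L\<close>-dimensional objects are reduced modulo \<open>L\<close>; differences are taken in the integers first.
\<close>

definition sub_mod :: "nat \<Rightarrow> nat \<Rightarrow> nat \<Rightarrow> nat" where
  "sub_mod L a b = nat ((int a - int b) mod int L)"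

definition hadamard_mat :: "complex mat \<Rightarrow> complex mat \<Rightarrow> complex mat" where
  "hadamard_mat A B = mat (dim_row A) (dim_col A) (\<lambda>(i, j). A $$ (i, j) * B $$ (i, j))"

definition hadamard_vec :: "complex vec \<Rightarrow> complex vec \<Rightarrow> complex vec" where
  "hadamard_vec u v = vec (dim_vec u) (\<lambda>i. u $ i * v $ i)"

definition kronecker :: "complex mat \<Rightarrow> complex mat \<Rightarrow> complex mat" where
  "kronecker A B = mat (dim_row A * dim_row B) (dim_col A * dim_col B)
     (\<lambda>(i, j). A $$ (i div dim_row B, j div dim_col B) * B $$ (i mod dim_row B, j mod dim_col B))"

text \<open>Column stacking.\<close>
definition vec_of_mat :: "complex mat \<Rightarrow> complex vec" where
  "vec_of_mat A = vec (dim_row A * dim_col A) (\<lambda>k. A $$ (k mod dim_row A, k div dim_row A))"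

definition conj_mat :: "complex mat \<Rightarrow> complex mat" where
  "conj_mat A = map_mat cnj A"

definition circulant :: "complex vec \<Rightarrow> complex mat" where
  "circulant z = mat (dim_vec z) (dim_vec z) (\<lambda>(k1, k2). z $ sub_mod (dim_vec z) k2 k1)"

definition hermitian_mat :: "complex mat \<Rightarrow> bool" where
  "hermitian_mat A \<longleftrightarrow> square_mat A \<and> mat_adjoint A = A"

text \<open>The order on the complex numbers is the one of \<open>Complex_Order\<close>: \<open>0 \<le> z\<close> says that
  \<open>z\<close> is real and nonnegative. The scalar \<open>(A *\<^sub>v v) \<bullet>c v\<close> is \<open>v\<^sup>* A v\<close>.\<close>
definition psd_mat :: "complex mat \<Rightarrow> bool" where
  "psd_mat A \<longleftrightarrow> square_mat A \<and> (\<forall>v \<in> carrier_vec (dim_row A). 0 \<le> (A *\<^sub>v v) \<bullet>c v)"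

text \<open>Eigenvalues in increasing order, repeated according to multiplicity; meant for Hermitian
  matrices, whose eigenvalues are real.\<close>
definition sorted_eigenvalues :: "complex mat \<Rightarrow> real list" where
  "sorted_eigenvalues A = sorted_list_of_multiset (image_mset Re (proots (char_poly A)))"

text \<open>The \<open>min m n\<close> singular values of an \<open>m \<times> n\<close> matrix in increasing order, repeated according
  to multiplicity: square roots of the eigenvalues of the smaller of the two Gram matrices.\<close>
definition singular_values :: "complex mat \<Rightarrow> real list" where
  "singular_values A = map sqrt (sorted_eigenvalues
     (if dim_col A \<le> dim_row A then mat_adjoint A * A else A * mat_adjoint A))"

definition right_singular_vector :: "complex mat \<Rightarrow> real \<Rightarrow> complex vec \<Rightarrow> bool" where
  "right_singular_vector A \<sigma> v \<longleftrightarrow>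
     v \<in> carrier_vec (dim_col A) \<and> v \<bullet>c v = 1 \<and>
     (\<exists>u \<in> carrier_vec (dim_row A). u \<bullet>c u = 1 \<and>
        A *\<^sub>v v = complex_of_real \<sigma> \<cdot>\<^sub>v u \<and> mat_adjoint A *\<^sub>v u = complex_of_real \<sigma> \<cdot>\<^sub>v v)"

text \<open>The columns of \<open>V\<close> are \<open>p\<close> orthonormal eigenvectors of the Hermitian matrix \<open>A\<close> for its \<open>p\<close>
  largest eigenvalues (with multiplicity), in an arbitrary order.\<close>
definition top_eigenvectors :: "nat \<Rightarrow> complex mat \<Rightarrow> complex mat \<Rightarrow> bool" where
  "top_eigenvectors p A V \<longleftrightarrow>
     V \<in> carrier_mat (dim_row A) p \<and>
     (\<forall>i < p. \<forall>j < p. col V i \<bullet>c col V j = (if i = j then 1 else 0)) \<and>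
     (\<exists>\<mu>. mset \<mu> = mset (take p (rev (sorted_eigenvalues A))) \<and> length \<mu> = p \<and>
        (\<forall>j < p. eigenvector A (col V j) (complex_of_real (\<mu> ! j))))"

text \<open>The matrix \<open>A \<odot> Circulant{[1, e\<^sup>i\<^sup>\<theta>\<^sup>(\<^sup>1\<^sup>), \<dots>, e\<^sup>i\<^sup>\<theta>\<^sup>(\<^sup>L\<^sup>-\<^sup>1\<^sup>)]}\<close>; the value \<open>\<theta> 0\<close> is not used.\<close>
definition phase_circulant :: "nat \<Rightarrow> complex mat \<Rightarrow> (nat \<Rightarrow> real) \<Rightarrow> complex mat" where
  "phase_circulant L A \<theta> =
     hadamard_mat A (circulant (vec L (\<lambda>m. if m = 0 then 1 else cis (\<theta> m))))"

definition dft_vec :: "nat \<Rightarrow> nat \<Rightarrow> complex vec" where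
  "dft_vec L l = vec L (\<lambda>k. exp (- \<i> * 2 * of_real pi * of_nat k * of_nat l / of_nat L))"

definition Omega :: "nat \<Rightarrow> complex mat \<Rightarrow> complex mat set" where
  "Omega L S = {mat_diag L (($) (dft_vec L l)) * S * mat_diag L (($) (conjugate (dft_vec L l))) | l. l < L}"

definition shift_mat :: "nat \<Rightarrow> nat \<Rightarrow> nat \<Rightarrow> complex mat \<Rightarrow> complex mat" where
  "shift_mat L i j X = mat L L (\<lambda>(k, m). X $$ (sub_mod L k i, sub_mod L m j))"

definition H_mat :: "nat \<Rightarrow> complex mat \<Rightarrow> nat \<Rightarrow> nat \<Rightarrow> complex mat" where
  "H_mat L X i j = hadamard_mat X (conj_mat (shift_mat L i j X))"

definition Z_mat :: "nat \<Rightarrow> (nat \<Rightarrow> complex mat) \<Rightarrow> nat \<Rightarrow> complex mat" where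
  "Z_mat L V i = kronecker (conj_mat (V ((i + 1) mod L))) (V i)"

definition M_vec :: "nat \<Rightarrow> complex mat \<Rightarrow> nat \<Rightarrow> nat \<Rightarrow> complex vec" where
  "M_vec L X i m =
     hadamard_vec (vec_of_mat (H_mat L X i (i + 1))) (vec_of_mat (circulant (unit_vec L m)))"

definition M_mat :: "nat \<Rightarrow> complex mat \<Rightarrow> complex mat" where
  "M_mat L X = mat (L ^ 3) L (\<lambda>(a, m). M_vec L X (a div L\<^sup>2) m $ (a mod L\<^sup>2))"

text \<open>The two matrices have the same number of rows, so the lower two blocks have no rows. The
  matrix depends on \<open>V\<close>, since the eigenvectors are only determined up to a choice.\<close>
definition W_mat :: "nat \<Rightarrow> complex mat \<Rightarrow> (nat \<Rightarrow> complex mat) \<Rightarrow> complex mat" where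
  "W_mat L X V =
     (let A = M_mat L X; B = - diag_block_mat (map (Z_mat L V) [0..<L])
      in four_block_mat A B (0\<^sub>m 0 (dim_col A)) (0\<^sub>m 0 (dim_col B)))"

end

theory Submission
  imports Defs
begin

text \<open>
  A positive semidefinite \<open>T\<close> that differs from \<open>X\<close> by a circulant of unit phases has
  \<open>H_mat L T i i = H_mat L X i i\<close>. Writing \<open>T = B B\<^sup>*\<close>, all products \<open>H_mat L T i j\<close> are \<open>E i (E j)\<^sup>*\<close>
  for matrices \<open>E i\<close> whose range is that of \<open>H_mat L X i i\<close>, so \<open>H_mat L T i (i + 1)\<close> is
  \<open>V i * G * (V (i + 1))\<^sup>*\<close> for some \<open>G\<close>; this says that the ratios of consecutive phases of \<open>T\<close> to
  \<open>X\<close> extend to a kernel vector of \<open>W\<close>. The singular value condition makes the kernel a line. The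
  kernel vectors of two such \<open>T\<close> are therefore proportional, and their phases differ by \<open>c\<^sup>m\<close>, where
  \<open>c\<^sup>L = 1\<close> because the ratios run once around the cycle. A singular vector for the smallest
  singular value spans the same line, so the formula for \<open>\<psi>\<close> telescopes to the true phases up to such
  a factor.
\<close>

subsection \<open>Eigenvalues and kernels of complex matrices\<close>

lemma index_mat_adjoint:
  assumes "i < dim_col A" "j < dim_row A"
  shows "mat_adjoint (A :: complex mat) $$ (i, j) = cnj (A $$ (j, i))"
  using assms by (simp add: mat_adjoint_def mat_of_rows_index)

lemma mat_adjoint_carrier:
  "A \<in> carrier_mat n m \<Longrightarrow> mat_adjoint (A :: complex mat) \<in> carrier_mat m n"
  by (auto simp: mat_adjoint_def)

lemma index_mult_mat_vec_sum:
  assumes "A \<in> carrier_mat n m" "v \<in> carrier_vec m" "i < n"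
  shows "(A *\<^sub>v v) $ i = (\<Sum>j<m. A $$ (i, j) * v $ j)"
  using assms by (auto simp: scalar_prod_def lessThan_atLeast0 intro!: sum.cong)

lemma index_mult_mat_sum:
  assumes "A \<in> carrier_mat n m" "B \<in> carrier_mat m k" "i < n" "j < k"
  shows "(A * B) $$ (i, j) = (\<Sum>l<m. A $$ (i, l) * B $$ (l, j))"
  using assms by (auto simp: scalar_prod_def lessThan_atLeast0 intro!: sum.cong)

text \<open>The linear factors of the characteristic polynomial commute, so Schur triangularization
  can be run with its roots listed in any order. Later uses depend on this freedom: a zero root is
  put first, or all nonzero roots are.\<close>

lemma schur_form_with_diagonal:
  assumes A: "(A :: complex mat) \<in> carrier_mat n n" and es: "mset es = proots (char_poly A)"
  obtains B P Q where "similar_mat_wit A B P Q" "upper_triangular B" "diag_mat B = es"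
proof -
  obtain as where as: "char_poly A = (\<Prod>a\<leftarrow>as. [:- a, 1:])"
    using char_poly_factorized[OF A] by blast
  have "proots (\<Prod>a\<leftarrow>bs. [:- a, 1:]) = mset bs" for bs :: "complex list"
  proof (induction bs)
    case (Cons b bs)
    have "(\<Prod>a\<leftarrow>bs. [:- a, 1:]) \<noteq> 0" by (auto simp: prod_list_zero_iff)
    then have "proots ([:- b, 1:] * (\<Prod>a\<leftarrow>bs. [:- a, 1:]))
        = proots [:- b, 1:] + proots (\<Prod>a\<leftarrow>bs. [:- a, 1:])" by (intro proots_mult) (auto simp: prod_list_zero_iff)
    then show ?case using Cons by simp
  qed simp
  then have "mset es = mset as" using es as by simp
  then have "mset (map (\<lambda>a. [:- a, 1:]) es) = mset (map (\<lambda>a. [:- a, 1:]) as)" by simp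
  then have "char_poly A = (\<Prod>a\<leftarrow>es. [:- a, 1:])"
    unfolding as by (metis prod_mset_prod_list)
  moreover obtain B P Q where "schur_decomposition A es = (B, P, Q)"
    by (metis prod_cases3)
  ultimately show ?thesis using schur_decomposition[OF A] that by blast
qed

text \<open>In a triangular form whose diagonal begins with the only zero, back substitution kills
  every coordinate of a kernel vector except the first. The kernel is thus contained in the line
  through the first column of the transforming matrix.\<close>

lemma simple_zero_root_kernel:
  assumes A: "(A :: complex mat) \<in> carrier_mat n n"
    and roots: "proots (char_poly A) = add_mset 0 R" "0 \<notin># R"
  obtains z where "\<And>x. x \<in> carrier_vec n \<Longrightarrow> A *\<^sub>v x = 0\<^sub>v n \<Longrightarrow> \<exists>c. x = c \<cdot>\<^sub>v z"
proof -
  obtain rs where rs: "mset rs = R" using ex_mset by blast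
  have "mset (0 # rs) = proots (char_poly A)" using rs roots by simp
  from schur_form_with_diagonal[OF A this] obtain B P Q
    where sim: "similar_mat_wit A B P Q" and ut: "upper_triangular B" and diag: "diag_mat B = 0 # rs"
    by blast
  note D = similar_mat_witD2[OF A sim]
  have n: "n = Suc (length rs)" using arg_cong[OF diag, of length] D(5) by (simp add: diag_mat_def)
  have diag_nz: "B $$ (i, i) \<noteq> 0" if "0 < i" "i < n" for i
  proof -
    have "B $$ (i, i) = (0 # rs) ! i" using that D(5) by (simp flip: diag) (simp add: diag_mat_def)
    also have "\<dots> \<in> set rs" using that n by (cases i) auto
    finally show ?thesis using roots(2) rs by (metis set_mset_mset)
  qed
  show ?thesis
  proof (rule that[of "col P 0"])
    fix x assume x: "x \<in> carrier_vec n" and Ax: "A *\<^sub>v x = 0\<^sub>v n"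
    define y where "y = Q *\<^sub>v x"
    have y: "y \<in> carrier_vec n" using D(7) x by (simp add: y_def)
    have "B *\<^sub>v y = (Q * A * P) *\<^sub>v y"
      using similar_mat_witD2(3)[OF D(5) similar_mat_wit_sym[OF sim]] by simp
    also have "\<dots> = Q *\<^sub>v (A *\<^sub>v ((P * Q) *\<^sub>v x))"
      using D(4-7) x by (simp add: y_def assoc_mult_mat_vec[of _ n n _ n])
    also have "\<dots> = 0\<^sub>v n" using D x Ax by auto
    finally have By: "B *\<^sub>v y = 0\<^sub>v n" .
    \<comment> \<open>Back substitution from the last row upwards: in row \<open>i\<close> the terms
      left of the diagonal vanish by triangularity, those to its right by induction on
      \<open>n - i\<close>.\<close>
    have y0: "y $ i = 0" if "0 < i" "i < n" for i
      using that
    proof (induction "n - i" arbitrary: i rule: less_induct)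
      case less
      have "0 = (\<Sum>j<n. B $$ (i, j) * y $ j)"
        using index_mult_mat_vec_sum[OF D(5) y less.prems(2)] By less.prems by simp
      also have "\<dots> = (\<Sum>j\<in>{i}. B $$ (i, j) * y $ j)"
      proof (rule sum.mono_neutral_right)
        show "\<forall>j\<in>{..<n} - {i}. B $$ (i, j) * y $ j = 0"
        proof
          fix j assume j: "j \<in> {..<n} - {i}"
          show "B $$ (i, j) * y $ j = 0"
            using j less upper_triangularD[OF ut, of j i] D(5)
            by (cases "j < i") auto
        qed
      qed (use less in auto)
      finally show ?case using diag_nz less.prems by simp
    qed
    have "x = P *\<^sub>v y"
      using D x by (simp add: y_def flip: assoc_mult_mat_vec[of _ n n _ n])
    also have "\<dots> = y $ 0 \<cdot>\<^sub>v col P 0"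
    proof (rule eq_vecI)
      fix i assume i: "i < dim_vec (y $ 0 \<cdot>\<^sub>v col P 0)"
      then have i: "i < n" using D(6) by simp
      have "(P *\<^sub>v y) $ i = (\<Sum>j<n. P $$ (i, j) * y $ j)"
        by (rule index_mult_mat_vec_sum[OF D(6) y i])
      also have "\<dots> = (\<Sum>j\<in>{0}. P $$ (i, j) * y $ j)"
        by (rule sum.mono_neutral_right) (use n y0 in auto)
      finally show "(P *\<^sub>v y) $ i = (y $ 0 \<cdot>\<^sub>v col P 0) $ i"
        using i n D(6) by simp
    qed (use D(6) in simp)
    finally show "\<exists>c. x = c \<cdot>\<^sub>v col P 0" by blast
  qed
qed

text \<open>The singular values are sorted, so a positive entry at index 1 leaves room for only one
  zero. The vector \<open>x\<close> makes 0 a root for the Gram matrix \<open>G\<close>; it must be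
  the first entry and a simple root, and the kernel of \<open>A\<close> lies in that of
  \<open>G\<close>.\<close>

lemma second_singular_value_kernel:
  assumes A: "A \<in> carrier_mat m n" and nm: "n \<le> m"
    and len: "1 < length (singular_values A)" and pos: "singular_values A ! 1 > 0"
    and x: "x \<in> carrier_vec n" "x \<noteq> 0\<^sub>v n" "A *\<^sub>v x = 0\<^sub>v m"
  shows "singular_values A ! 0 = 0"
    and "\<exists>z. \<forall>y \<in> carrier_vec n. A *\<^sub>v y = 0\<^sub>v m \<longrightarrow> (\<exists>c. y = c \<cdot>\<^sub>v z)"
proof -
  define G where "G = mat_adjoint A * A"
  have A': "mat_adjoint A \<in> carrier_mat n m" using A by (rule mat_adjoint_carrier)
  have G: "G \<in> carrier_mat n n" using A A' by (simp add: G_def)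
  have Gy: "G *\<^sub>v y = 0\<^sub>v n" if "y \<in> carrier_vec n" "A *\<^sub>v y = 0\<^sub>v m" for y
    using that A A' by (auto simp: G_def assoc_mult_mat_vec[of _ n m _ n])
  define xs where "xs = sorted_eigenvalues G"
  have sv: "singular_values A = map sqrt xs"
    using A nm by (simp add: singular_values_def xs_def G_def)
  have mxs: "mset xs = image_mset Re (proots (char_poly G))"
    by (simp add: xs_def sorted_eigenvalues_def)
  have sorted: "sorted xs" by (simp add: xs_def sorted_eigenvalues_def)
  have "eigenvalue G 0"
    unfolding eigenvalue_def eigenvector_def using x Gy G
    by (intro exI[of _ x]) auto
  then have "poly (char_poly G) 0 = 0" using eigenvalue_root_char_poly[OF G] by simp
  moreover have "char_poly G \<noteq> 0" using degree_monic_char_poly[OF G] by auto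
  ultimately have "0 \<in># proots (char_poly G)" by simp
  then obtain R where R: "proots (char_poly G) = add_mset 0 R" by (metis multi_member_split)
  obtain a b ys where xs: "xs = a # b # ys"
    using len sv by (cases xs; cases "tl xs") auto
  \<comment> \<open>The real \<open>sqrt\<close> preserves signs on the whole line, so nonnegativity
    of the eigenvalues of \<open>G\<close> need not be established first.\<close>
  have b: "b > 0" using pos sv xs by simp
  then have tail: "c > 0" if "c \<in> set (b # ys)" for c
    using that sorted xs by auto
  have "0 \<in> set xs" using mxs R by (metis image_mset_add_mset set_mset_mset union_single_eq_member zero_complex.simps(1))
  then have a: "a = 0" using tail xs by auto
  then show "singular_values A ! 0 = 0" using sv xs by simp
  have "image_mset Re R = mset (b # ys)" using mxs R xs a by simp
  then have "0 \<notin># R" using tail by (metis image_eqI less_irrefl set_image_mset set_mset_mset zero_complex.simps(1))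
  from simple_zero_root_kernel[OF G R this] obtain z
    where "\<And>y. y \<in> carrier_vec n \<Longrightarrow> G *\<^sub>v y = 0\<^sub>v n \<Longrightarrow> \<exists>c. y = c \<cdot>\<^sub>v z" by blast
  then show "\<exists>z. \<forall>y \<in> carrier_vec n. A *\<^sub>v y = 0\<^sub>v m \<longrightarrow> (\<exists>c. y = c \<cdot>\<^sub>v z)"
    using Gy by blast
qed

text \<open>If more than \<open>p\<close> roots were nonzero, listing them first in a Schur form
  would give an invertible leading triangular block of size \<open>k > p\<close>. But this block
  factors through dimension \<open>p\<close>, so its determinant vanishes.\<close>

lemma size_nonzero_roots_le:
  assumes C: "(C :: complex mat) \<in> carrier_mat n p" and D: "D \<in> carrier_mat p n"
  shows "size {#x \<in># proots (char_poly (C * D)). x \<noteq> 0#} \<le> p"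
proof (rule ccontr)
  define A where "A = C * D"
  have A: "A \<in> carrier_mat n n" using C D by (simp add: A_def)
  obtain nz where nz: "mset nz = {#x \<in># proots (char_poly A). x \<noteq> 0#}" using ex_mset by blast
  obtain zs where zs: "mset zs = {#x \<in># proots (char_poly A). \<not> x \<noteq> 0#}" using ex_mset by blast
  define k where "k = length nz"
  assume "\<not> ?thesis"
  then have pk: "p < k" using nz by (metis A_def k_def not_less size_mset)
  have "mset (nz @ zs) = proots (char_poly A)" using nz zs by (simp flip: multiset_partition)
  from schur_form_with_diagonal[OF A this] obtain B P Q
    where sim: "similar_mat_wit A B P Q" and ut: "upper_triangular B" and diag: "diag_mat B = nz @ zs"
    by blast
  note S = similar_mat_witD2[OF A sim]
  have kn: "k \<le> n" using arg_cong[OF diag, of length] S(5) by (simp add: diag_mat_def k_def)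
  have QC: "Q * C \<in> carrier_mat n p" and DP: "D * P \<in> carrier_mat p n" using C D S by auto
  have "B = Q * A * P" using similar_mat_witD2(3)[OF S(5) similar_mat_wit_sym[OF sim]] .
  also have "\<dots> = (Q * C) * (D * P)"
    using C D S(6,7) by (simp add: A_def assoc_mult_mat[of _ n n _ p _ n] assoc_mult_mat[of _ n p _ n _ n]
        assoc_mult_mat[of _ n n _ n _ n] mult_carrier_mat[of _ p n _ n] mult_carrier_mat[of _ n p _ n])
  finally have B: "B = (Q * C) * (D * P)" .
  \<comment> \<open>Both factors of the leading block are padded with zeros to size
    \<open>k\<close>, so that determinants multiply. Column \<open>p\<close> of \<open>C'\<close> is
    then zero, which makes \<open>C'\<close> singular.\<close>
  define B' where "B' = mat k k (\<lambda>(i, j). B $$ (i, j))"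
  define C' where "C' = mat k k (\<lambda>(i, j). if j < p then (Q * C) $$ (i, j) else 0)"
  define D' where "D' = mat k k (\<lambda>(i, j). if i < p then (D * P) $$ (i, j) else 0)"
  have carr: "B' \<in> carrier_mat k k" "C' \<in> carrier_mat k k" "D' \<in> carrier_mat k k"
    by (auto simp: B'_def C'_def D'_def)
  have "B' = C' * D'"
  proof (rule eq_matI)
    fix i j assume "i < dim_row (C' * D')" "j < dim_col (C' * D')"
    then have ij: "i < k" "j < k" using carr by auto
    have "(C' * D') $$ (i, j) = (\<Sum>l<k. C' $$ (i, l) * D' $$ (l, j))"
      by (rule index_mult_mat_sum[OF carr(2,3) ij])
    also have "\<dots> = (\<Sum>l<p. C' $$ (i, l) * D' $$ (l, j))"
      by (rule sum.mono_neutral_right) (use pk ij in \<open>auto simp: C'_def\<close>)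
    also have "\<dots> = (\<Sum>l<p. (Q * C) $$ (i, l) * (D * P) $$ (l, j))"
      by (rule sum.cong) (use pk ij in \<open>auto simp: C'_def D'_def\<close>)
    also have "\<dots> = B $$ (i, j)"
      unfolding B by (rule index_mult_mat_sum[OF QC DP, symmetric]) (use ij kn in auto)
    finally show "B' $$ (i, j) = (C' * D') $$ (i, j)" using ij by (simp add: B'_def)
  qed (use carr in auto)
  then have "det B' = det C' * det D'" using det_mult[OF carr(2,3)] by simp
  also have "det C' = 0"
    unfolding det_0_iff_vec_prod_zero[OF carr(2)]
  proof (intro exI[of _ "unit_vec k p"] conjI)
    show "C' *\<^sub>v unit_vec k p = 0\<^sub>v k"
      by (rule eq_vecI) (use pk in \<open>auto simp: C'_def scalar_prod_right_unit\<close>)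
  qed (use pk in auto)
  finally have "det B' = 0" by simp
  moreover have "upper_triangular B'"
    using upper_triangularD[OF ut] kn S(5) by (auto simp: B'_def intro!: upper_triangularI)
  ultimately have "0 \<in> set (diag_mat B')"
    using upper_triangular_imp_det_eq_0_iff[OF carr(1)] by auto
  then obtain i where i: "i < k" "B $$ (i, i) = 0" using carr(1) by (auto simp: diag_mat_def B'_def)
  then have "(nz @ zs) ! i = 0" using kn S(5) by (simp flip: diag) (simp add: diag_mat_def)
  then have "0 \<in> set nz" using i by (auto simp: nth_append k_def in_set_conv_nth)
  then show False using nz by (metis (mono_tags, lifting) mem_Collect_eq set_mset_filter set_mset_mset)
qed

section \<open>Trace and projection onto the top eigenvectors\<close>

lemma trace_eq_sum_roots:
  assumes A: "(A :: complex mat) \<in> carrier_mat n n"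
  shows "(\<Sum>i<n. A $$ (i, i)) = sum_mset (proots (char_poly A))"
proof -
  obtain es where es: "mset es = proots (char_poly A)" using ex_mset by blast
  from schur_form_with_diagonal[OF A this] obtain B P Q
    where sim: "similar_mat_wit A B P Q" and diag: "diag_mat B = es" by blast
  note S = similar_mat_witD2[OF A sim]
  have PB: "P * B \<in> carrier_mat n n" using S by simp
  have tr: "(\<Sum>i<n. (M * N) $$ (i, i)) = (\<Sum>i<n. (N * M) $$ (i, i))"
    if "M \<in> carrier_mat n n" "N \<in> carrier_mat n n" for M N :: "complex mat"
  proof -
    have "(\<Sum>i<n. (M * N) $$ (i, i)) = (\<Sum>i<n. \<Sum>j<n. M $$ (i, j) * N $$ (j, i))"
      by (intro sum.cong refl index_mult_mat_sum[OF that]) auto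
    also have "\<dots> = (\<Sum>j<n. \<Sum>i<n. N $$ (j, i) * M $$ (i, j))"
      by (subst sum.swap) (simp add: mult.commute)
    also have "\<dots> = (\<Sum>i<n. (N * M) $$ (i, i))"
      by (intro sum.cong refl index_mult_mat_sum[OF that(2,1), symmetric]) auto
    finally show ?thesis .
  qed
  have "(\<Sum>i<n. A $$ (i, i)) = (\<Sum>i<n. (Q * (P * B)) $$ (i, i))"
    using tr[OF PB S(7)] S(3) by simp
  also have "Q * (P * B) = B"
    using S(1,2) assoc_mult_mat[OF S(7,6,5)] S(5) by simp
  also have "(\<Sum>i<n. B $$ (i, i)) = sum_list es"
    using S(5) unfolding diag[symmetric] diag_mat_def
    by (simp add: interv_sum_list_conv_sum_set_nat lessThan_atLeast0)
  also have "\<dots> = sum_mset (proots (char_poly A))"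
    unfolding es[symmetric] by (rule sum_mset_sum_list[symmetric])
  finally show ?thesis .
qed

text \<open>A positive entry after the first \<open>p\<close> in decreasing order would make those
  \<open>p\<close> positive as well, which is one too many. Hence everything dropped is at most
  0.\<close>

lemma sum_list_le_sum_top:
  fixes xs :: "real list"
  assumes "sorted xs" and pos: "length (filter (\<lambda>x. x > 0) xs) \<le> p"
  shows "sum_list xs \<le> sum_list (take p (rev xs))"
proof -
  define ys where "ys = rev xs"
  have "x \<le> 0" if x: "x \<in> set (drop p ys)" for x
  proof (rule ccontr)
    assume "\<not> x \<le> 0"
    moreover have "sorted_wrt (\<ge>) (take p ys @ drop p ys)"
      using assms(1) by (simp add: ys_def sorted_wrt_rev)
    then have "\<forall>y\<in>set (take p ys). x \<le> y" using x by (simp only: sorted_wrt_append) blast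
    ultimately have all: "filter (\<lambda>x. x > 0) (take p ys) = take p ys" by (auto simp: filter_id_conv)
    have "filter (\<lambda>x. x > 0) (drop p ys) \<noteq> []" using x \<open>\<not> x \<le> 0\<close> by (auto simp: filter_empty_conv not_le)
    then have "length (filter (\<lambda>x. x > 0) (take p ys @ drop p ys)) > length (take p ys)"
      by (simp only: filter_append all) simp
    moreover have "length (take p ys) = p" using x by (auto simp: min_def)
    moreover have "length (filter (\<lambda>x. x > 0) (take p ys @ drop p ys)) \<le> p"
      using pos by (simp add: ys_def rev_filter[symmetric])
    ultimately show False by simp
  qed
  then have "sum_list (drop p ys) \<le> 0" by (simp add: sum_list_nonpos)
  moreover have "sum_list xs = sum_list (take p ys @ drop p ys)" by (simp add: ys_def sum_list_rev)
  ultimately show ?thesis by (simp only: sum_list_append) (simp add: ys_def)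
qed

text \<open>Pythagoras for the projection \<open>y\<close> of \<open>x\<close> onto the span of the
  orthonormal columns: both mixed products and the square of \<open>y\<close> equal the sum of the
  squared coefficients. The exact identity, unlike Bessel's inequality, can be summed over many
  vectors and compared with a trace.\<close>

lemma bessel_residual:
  fixes x :: "nat \<Rightarrow> complex" and V :: "nat \<Rightarrow> nat \<Rightarrow> complex"
  assumes orth: "\<And>a b. a < p \<Longrightarrow> b < p \<Longrightarrow>
    (\<Sum>k<n. V k a * cnj (V k b)) = (if a = b then 1 else 0)"
  defines "c \<equiv> \<lambda>b. \<Sum>k<n. x k * cnj (V k b)"
  defines "y \<equiv> \<lambda>k. \<Sum>b<p. c b * V k b"
  shows "(\<Sum>k<n. (x k - y k) * cnj (x k - y k)) =
    (\<Sum>k<n. x k * cnj (x k)) - (\<Sum>b<p. c b * cnj (c b))"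
proof -
  have xy: "(\<Sum>k<n. x k * cnj (y k)) = (\<Sum>b<p. c b * cnj (c b))"
  proof -
    have "(\<Sum>k<n. x k * cnj (y k)) = (\<Sum>k<n. \<Sum>b<p. x k * cnj (V k b) * cnj (c b))"
      by (simp add: y_def sum_distrib_left mult_ac)
    also have "\<dots> = (\<Sum>b<p. \<Sum>k<n. x k * cnj (V k b) * cnj (c b))" by (rule sum.swap)
    also have "\<dots> = (\<Sum>b<p. c b * cnj (c b))" by (simp add: c_def sum_distrib_right)
    finally show ?thesis .
  qed
  have yx: "(\<Sum>k<n. y k * cnj (x k)) = (\<Sum>b<p. c b * cnj (c b))"
    using arg_cong[OF xy, of cnj] by (simp add: mult.commute)
  have yy: "(\<Sum>k<n. y k * cnj (y k)) = (\<Sum>b<p. c b * cnj (c b))"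
  proof -
    have "(\<Sum>k<n. y k * cnj (y k)) =
        (\<Sum>k<n. \<Sum>a<p. \<Sum>b<p. (c a * cnj (c b)) * (V k a * cnj (V k b)))"
      by (simp add: y_def sum_product mult_ac)
    also have "\<dots> = (\<Sum>a<p. \<Sum>k<n. \<Sum>b<p. (c a * cnj (c b)) * (V k a * cnj (V k b)))"
      by (rule sum.swap)
    also have "\<dots> = (\<Sum>a<p. \<Sum>b<p. \<Sum>k<n. (c a * cnj (c b)) * (V k a * cnj (V k b)))"
      by (intro sum.cong refl sum.swap)
    also have "\<dots> = (\<Sum>a<p. \<Sum>b<p. (c a * cnj (c b)) * (if a = b then 1 else 0))"
      by (intro sum.cong refl) (simp add: orth flip: sum_distrib_left)
    also have "\<dots> = (\<Sum>a<p. c a * cnj (c a))" by (simp add: if_distrib cong: if_cong)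
    finally show ?thesis .
  qed
  show ?thesis
    using xy yx yy by (simp add: algebra_simps sum.distrib sum_subtractf)
qed

lemma Re_sum_mset: "Re (sum_mset M) = sum_mset (image_mset Re M)"
  by (induction M) simp_all

text \<open>The residuals of the columns of \<open>E\<close> have total squared norm \<open>tr H - \<Sum>\<mu>\<close>, and the trace is
  at most the sum of the \<open>p\<close> largest eigenvalues because at most \<open>p\<close> of them are nonzero.\<close>
lemma top_eigenvectors_project:
  fixes E :: "nat \<Rightarrow> 'c \<Rightarrow> complex"
  assumes H: "H \<in> carrier_mat n n" and top: "top_eigenvectors p H V"
    and E: "\<And>k l. k < n \<Longrightarrow> l < n \<Longrightarrow> H $$ (k, l) = (\<Sum>c\<in>C. E k c * cnj (E l c))"
    and fin: "finite C"
    and nonzero: "size {#x \<in># proots (char_poly H). x \<noteq> 0#} \<le> p"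
    and k: "k < n" and c: "c \<in> C"
  shows "(\<Sum>b<p. (\<Sum>l<n. E l c * cnj (V $$ (l, b))) * V $$ (k, b)) = E k c"
proof -
  have V: "V \<in> carrier_mat n p"
    and orth': "\<And>i j. i < p \<Longrightarrow> j < p \<Longrightarrow> col V i \<bullet>c col V j = (if i = j then 1 else 0)"
    using top H by (auto simp: top_eigenvectors_def)
  obtain \<mu> where mu: "mset \<mu> = mset (take p (rev (sorted_eigenvalues H)))" "length \<mu> = p"
    and ev: "\<And>j. j < p \<Longrightarrow> eigenvector H (col V j) (complex_of_real (\<mu> ! j))"
    using top by (auto simp: top_eigenvectors_def)
  have orth: "(\<Sum>k<n. V $$ (k, a) * cnj (V $$ (k, b))) = (if a = b then 1 else 0)"
    if "a < p" "b < p" for a b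
    using orth'[OF that] that V by (simp add: scalar_prod_def lessThan_atLeast0)
  define d where "d = (\<lambda>c b. \<Sum>l<n. E l c * cnj (V $$ (l, b)))"
  define R where "R = (\<lambda>k c. E k c - (\<Sum>b<p. d c b * V $$ (k, b)))"
  \<comment> \<open>Summed over \<open>c\<close>, the squared coefficients along the eigenvector
    \<open>v\<close> in column \<open>b\<close> form the Rayleigh quotient \<open>v^* H v\<close>,
    because \<open>H\<close> is the Gram matrix of the rows of \<open>E\<close>.\<close>
  have quad: "(\<Sum>c\<in>C. d c b * cnj (d c b)) = \<mu> ! b" if b: "b < p" for b
  proof -
    have Hv: "(\<Sum>k<n. H $$ (l, k) * V $$ (k, b)) = \<mu> ! b * V $$ (l, b)" if l: "l < n" for l
    proof -
      have "(\<Sum>k<n. H $$ (l, k) * V $$ (k, b)) = (\<Sum>k<n. H $$ (l, k) * col V b $ k)"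
        using V b by simp
      also have "\<dots> = (H *\<^sub>v col V b) $ l"
        using index_mult_mat_vec_sum[OF H _ l] V b by simp
      also have "\<dots> = \<mu> ! b * V $$ (l, b)"
        using ev[OF b] V b l by (simp add: eigenvector_def)
      finally show ?thesis .
    qed
    have "(\<Sum>c\<in>C. d c b * cnj (d c b)) =
        (\<Sum>c\<in>C. \<Sum>l<n. \<Sum>k<n. cnj (V $$ (l, b)) * (E l c * cnj (E k c)) * V $$ (k, b))"
      by (simp add: d_def sum_product mult_ac)
    also have "\<dots> = (\<Sum>l<n. \<Sum>c\<in>C. \<Sum>k<n. cnj (V $$ (l, b)) * (E l c * cnj (E k c)) * V $$ (k, b))"
      by (rule sum.swap)
    also have "\<dots> = (\<Sum>l<n. \<Sum>k<n. \<Sum>c\<in>C. cnj (V $$ (l, b)) * (E l c * cnj (E k c)) * V $$ (k, b))"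
      by (intro sum.cong refl sum.swap)
    also have "\<dots> = (\<Sum>l<n. \<Sum>k<n. cnj (V $$ (l, b)) * H $$ (l, k) * V $$ (k, b))"
      by (intro sum.cong refl) (simp add: E sum_distrib_left sum_distrib_right)
    also have "\<dots> = (\<Sum>l<n. cnj (V $$ (l, b)) * (\<mu> ! b * V $$ (l, b)))"
      by (intro sum.cong refl) (simp add: mult.assoc Hv flip: sum_distrib_left)
    also have "\<dots> = \<mu> ! b * (\<Sum>l<n. V $$ (l, b) * cnj (V $$ (l, b)))"
      by (simp add: sum_distrib_left mult_ac)
    also have "\<dots> = \<mu> ! b" using orth[OF b b] by simp
    finally show ?thesis .
  qed
  have "(\<Sum>c\<in>C. \<Sum>k<n. R k c * cnj (R k c)) =
      (\<Sum>c\<in>C. (\<Sum>k<n. E k c * cnj (E k c)) - (\<Sum>b<p. d c b * cnj (d c b)))"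
    unfolding R_def d_def by (intro sum.cong refl bessel_residual orth)
  also have "\<dots> = (\<Sum>c\<in>C. \<Sum>k<n. E k c * cnj (E k c)) - (\<Sum>c\<in>C. \<Sum>b<p. d c b * cnj (d c b))"
    by (rule sum_subtractf)
  also have "(\<Sum>c\<in>C. \<Sum>k<n. E k c * cnj (E k c)) = (\<Sum>k<n. H $$ (k, k))"
    by (subst sum.swap) (simp add: E)
  also have "(\<Sum>c\<in>C. \<Sum>b<p. d c b * cnj (d c b)) = (\<Sum>b<p. complex_of_real (\<mu> ! b))"
    by (subst sum.swap) (simp add: quad)
  finally have "Re (\<Sum>c\<in>C. \<Sum>k<n. R k c * cnj (R k c)) =
      Re (\<Sum>k<n. H $$ (k, k)) - (\<Sum>b<p. \<mu> ! b)" by simp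
  also have "(\<Sum>b<p. \<mu> ! b) = sum_list (take p (rev (sorted_eigenvalues H)))"
    using mu by (metis sum_list_sum_nth sum_mset_sum_list lessThan_atLeast0)
  also have "Re (\<Sum>k<n. H $$ (k, k)) = sum_mset (image_mset Re (proots (char_poly H)))"
    unfolding trace_eq_sum_roots[OF H]
    by (rule Re_sum_mset)
  also have "\<dots> = sum_list (sorted_eigenvalues H)"
    by (simp add: sorted_eigenvalues_def flip: sum_mset_sum_list)
  also have "\<dots> - sum_list (take p (rev (sorted_eigenvalues H))) \<le> 0"
  proof -
    \<comment> \<open>A root with positive real part is nonzero, so the bound on nonzero roots also
      bounds the positive entries of the sorted list of real parts.\<close>
    have "mset (filter (\<lambda>x. x > 0) (sorted_eigenvalues H)) =
        image_mset Re {#x \<in># proots (char_poly H). Re x > 0#}"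
      by (simp add: sorted_eigenvalues_def filter_mset_image_mset)
    then have "length (filter (\<lambda>x. x > 0) (sorted_eigenvalues H)) =
        size {#x \<in># proots (char_poly H). Re x > 0#}"
      by (metis size_image_mset size_mset)
    also have "\<dots> \<le> size {#x \<in># proots (char_poly H). x \<noteq> 0#}"
      by (intro size_mset_mono) (auto simp: subseteq_mset_def intro!: mset_subset_eqI)
    finally show ?thesis
      using nonzero sum_list_le_sum_top[of "sorted_eigenvalues H" p]
      by (simp add: sorted_eigenvalues_def)
  qed
  finally have "(\<Sum>c\<in>C. \<Sum>k<n. (cmod (R k c))\<^sup>2) \<le> 0"
    by (simp flip: complex_norm_square of_real_power of_real_sum)
  then have "(\<Sum>c\<in>C. \<Sum>k<n. (cmod (R k c))\<^sup>2) = 0"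
    by (intro antisym sum_nonneg) auto
  then have "(\<Sum>k<n. (cmod (R k c))\<^sup>2) = 0"
    using c fin by (subst (asm) sum_nonneg_eq_0_iff) (auto intro!: sum_nonneg)
  then have "(cmod (R k c))\<^sup>2 = 0"
    using k by (subst (asm) sum_nonneg_eq_0_iff) auto
  then show ?thesis by (simp add: R_def d_def)
qed

subsection \<open>Factorizations\<close>

text \<open>Entries are given by plain functions here, so that elimination can alter them without
  carrier conditions.\<close>

definition quadratic_form :: "nat \<Rightarrow> (nat \<Rightarrow> nat \<Rightarrow> complex) \<Rightarrow> (nat \<Rightarrow> complex) \<Rightarrow> complex" where
  "quadratic_form n A x = (\<Sum>i<n. \<Sum>j<n. cnj (x i) * A i j * x j)"

lemma quadratic_form_unit:
  assumes "m < n"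
  shows "quadratic_form n A (\<lambda>j. if j = m then 1 else 0) = A m m"
proof -
  have "quadratic_form n A (\<lambda>j. if j = m then 1 else 0) =
      (\<Sum>i<n. \<Sum>j<n. if j = m then (if i = m then A m m else 0) else 0)"
    unfolding quadratic_form_def by (intro sum.cong refl) auto
  then show ?thesis using assms by simp
qed

definition hermitian_on :: "nat \<Rightarrow> (nat \<Rightarrow> nat \<Rightarrow> complex) \<Rightarrow> bool" where
  "hermitian_on n A \<longleftrightarrow> (\<forall>i<n. \<forall>j<n. A i j = cnj (A j i))"

lemma hermitian_onD: "hermitian_on n A \<Longrightarrow> i < n \<Longrightarrow> j < n \<Longrightarrow> A i j = cnj (A j i)"
  unfolding hermitian_on_def by blast

text \<open>Moving one coordinate by \<open>s\<close> changes the form by a quadratic expression in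
  \<open>s\<close>. One choice of \<open>s\<close> drives the form negative when a diagonal entry is
  0, another completes the square in the Cholesky step.\<close>

lemma quadratic_form_perturb:
  fixes x :: "nat \<Rightarrow> complex"
  assumes herm: "hermitian_on n A" and m: "m < n"
  defines "r \<equiv> (\<Sum>j<n. A m j * x j)"
  shows "quadratic_form n A (\<lambda>i. x i + (if i = m then s else 0)) =
    quadratic_form n A x + cnj s * r + s * cnj r + cnj s * s * A m m"
proof -
  have r: "cnj r = (\<Sum>i<n. cnj (x i) * A i m)"
    unfolding r_def cnj_sum
    by (intro sum.cong refl) (simp add: hermitian_onD[OF herm _ m] mult.commute)
  have "quadratic_form n A (\<lambda>i. x i + (if i = m then s else 0)) =
    (\<Sum>i<n. \<Sum>j<n. cnj (x i) * A i j * x j + (if i = m then cnj s * (A m j * x j) else 0)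
       + (if j = m then s * (cnj (x i) * A i m) else 0)
       + (if i = m then (if j = m then cnj s * s * A m m else 0) else 0))"
    unfolding quadratic_form_def by (intro sum.cong refl) (auto simp: algebra_simps)
  also have "\<dots> = quadratic_form n A x + (\<Sum>j<n. cnj s * (A m j * x j))
       + (\<Sum>i<n. s * (cnj (x i) * A i m)) + cnj s * s * A m m"
  proof -
    have row: "(\<Sum>j<n. if i = m then f j else 0) = (if i = m then (\<Sum>j<n. f j) else 0)"
      for i and f :: "nat \<Rightarrow> complex" by simp
    show ?thesis
      unfolding sum.distrib quadratic_form_def row using m by simp
  qed
  also have "\<dots> = quadratic_form n A x + cnj s * r + s * cnj r + cnj s * s * A m m"
    unfolding r by (simp add: r_def sum_distrib_left)
  finally show ?thesis .
qed

text \<open>With a zero on the diagonal at \<open>m\<close>, the form at \<open>e_i + s e_m\<close>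
  has no quadratic term in \<open>s\<close>, so a nonzero \<open>A m i\<close> would make it
  unbounded below.\<close>

lemma psd_zero_diagonal:
  assumes herm: "hermitian_on n A"
    and psd: "\<And>x. 0 \<le> Re (quadratic_form n A x)"
    and m: "m < n" "A m m = 0" and i: "i < n"
  shows "A m i = 0"
proof (rule ccontr)
  assume nz: "A m i \<noteq> 0"
  define e where "e = (\<lambda>j. if j = i then 1 else 0 :: complex)"
  \<comment> \<open>\<open>t\<close> is chosen so that the two linear terms add up to
    \<open>- (Re (A i i) + 1)\<close>, which brings the real part of the form to exactly -1.\<close>
  define t where "t = (Re (A i i) + 1) / (2 * (cmod (A m i))\<^sup>2)"
  define s where "s = - of_real t * A m i"
  have r: "(\<Sum>j<n. A m j * e j) = A m i" using i by (simp add: e_def if_distrib cong: if_cong)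
  have q: "quadratic_form n A e = A i i"
    unfolding e_def by (rule quadratic_form_unit[OF i])
  have t: "t * (cmod (A m i))\<^sup>2 = (Re (A i i) + 1) / 2" using nz by (simp add: t_def)
  have s1: "cnj s * A m i = - of_real ((Re (A i i) + 1) / 2)"
    unfolding t[symmetric] of_real_mult complex_norm_square by (simp add: s_def)
  have s2: "s * cnj (A m i) = - of_real ((Re (A i i) + 1) / 2)"
    unfolding t[symmetric] of_real_mult complex_norm_square by (simp add: s_def)
  have "quadratic_form n A (\<lambda>j. e j + (if j = m then s else 0)) =
     A i i + - of_real ((Re (A i i) + 1) / 2) + - of_real ((Re (A i i) + 1) / 2)"
    unfolding quadratic_form_perturb[OF herm m(1)] r q m(2) s1 s2 by simp
  then have "Re (quadratic_form n A (\<lambda>j. e j + (if j = m then s else 0))) = - 1"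
    by (simp only: plus_complex.sel uminus_complex.sel Re_complex_of_real) (simp add: field_simps)
  then show False using psd[of "\<lambda>j. e j + (if j = m then s else 0)"] by linarith
qed

text \<open>Cholesky elimination: at each step a rank one term is split off that clears one more row and
  column and leaves a positive semidefinite remainder.\<close>
lemma psd_partial_factorization:
  assumes herm: "hermitian_on n A"
    and psd: "\<And>x. 0 \<le> Re (quadratic_form n A x)" and "m \<le> n"
  shows "\<exists>B R. (\<forall>i<n. \<forall>j<n. A i j = (\<Sum>a<m. B i a * cnj (B j a)) + R i j) \<and>
    hermitian_on n R \<and> (\<forall>x. 0 \<le> Re (quadratic_form n R x)) \<and> (\<forall>i<m. \<forall>j<n. R i j = 0)"
  using \<open>m \<le> n\<close>
proof (induction m)
  case 0
  show ?case using herm psd by (intro exI[of _ "\<lambda>_ _. 0"] exI[of _ A]) auto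
next
  case (Suc m)
  have m: "m < n" using Suc.prems by simp
  from Suc.IH m obtain B R
    where B': "\<forall>i<n. \<forall>j<n. A i j = (\<Sum>a<m. B i a * cnj (B j a)) + R i j"
    and hR: "hermitian_on n R" and pR: "\<forall>x. 0 \<le> Re (quadratic_form n R x)"
    and zR: "\<forall>i<m. \<forall>j<n. R i j = 0"
    using less_imp_le by blast
  have B: "A i j = (\<Sum>a<m. B i a * cnj (B j a)) + R i j" if "i < n" "j < n" for i j
    using B' that by blast
  show ?case
  proof (cases "R m m = 0")
    case True
    \<comment> \<open>A zero pivot already has a zero row, so nothing needs to be split off and the
      new column of \<open>B\<close> is 0.\<close>
    have "R m j = 0" if "j < n" for j
      using psd_zero_diagonal[of n R m j, OF hR _ m True that] pR by blast
    then have "\<forall>i<Suc m. \<forall>j<n. R i j = 0" using zR by (auto simp: less_Suc_eq)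
    moreover have "\<forall>i<n. \<forall>j<n. A i j =
        (\<Sum>a<Suc m. (if a = m then 0 else B i a) * cnj (if a = m then 0 else B j a)) + R i j"
      by (simp add: B)
    ultimately show ?thesis
      using hR pR by (intro exI[of _ "\<lambda>i a. if a = m then 0 else B i a"] exI[of _ R] conjI)
  next
    case False
    define a where "a = Re (R m m)"
    have Rmm: "R m m = of_real a"
      using hermitian_onD[OF hR m m] by (simp add: a_def complex_eq_iff)
    have "a \<ge> 0"
      using pR[rule_format, of "\<lambda>j. if j = m then 1 else 0"]
      by (simp add: a_def quadratic_form_unit[OF m])
    then have a: "a > 0" using False Rmm by (cases "a = 0") auto
    \<comment> \<open>The new column is the pivot column divided by the root of the pivot; what
      remains is the Schur complement \<open>R'\<close>.\<close>
    define B' where "B' = (\<lambda>i c. if c = m then R i m / of_real (sqrt a) else B i c)"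
    define R' where "R' = (\<lambda>i j. R i j - R i m * R m j / of_real a)"
    have "A i j = (\<Sum>a<Suc m. B' i a * cnj (B' j a)) + R' i j" if ij: "i < n" "j < n" for i j
    proof -
      have "complex_of_real (sqrt a) * complex_of_real (sqrt a) = complex_of_real a"
        using a by (simp flip: of_real_mult)
      then have "B' i m * cnj (B' j m) = R i m * R m j / of_real a"
        by (simp add: B'_def hermitian_onD[OF hR m ij(2)])
      moreover have "(\<Sum>a<m. B' i a * cnj (B' j a)) = (\<Sum>a<m. B i a * cnj (B j a))"
        by (intro sum.cong refl) (auto simp: B'_def)
      ultimately show ?thesis by (simp add: R'_def B[OF ij])
    qed
    moreover have "hermitian_on n R'"
      unfolding hermitian_on_def
    proof (intro allI impI)
      fix i j assume ij: "i < n" "j < n"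
      have "R i j = cnj (R j i)" "R i m = cnj (R m i)" "R m j = cnj (R j m)"
        using hermitian_onD[OF hR] ij m by blast+
      then show "R' i j = cnj (R' j i)" by (simp only: R'_def) simp
    qed
    moreover have "0 \<le> Re (quadratic_form n R' x)" for x
    proof -
      define r where "r = (\<Sum>j<n. R m j * x j)"
      have cr: "cnj r = (\<Sum>i<n. cnj (x i) * R i m)"
        unfolding r_def cnj_sum
        by (intro sum.cong refl) (simp add: hermitian_onD[OF hR _ m] mult.commute)
      have "quadratic_form n R' x = (\<Sum>i<n. \<Sum>j<n.
          cnj (x i) * R i j * x j - (cnj (x i) * R i m) * (R m j * x j) / of_real a)"
        unfolding quadratic_form_def R'_def by (intro sum.cong refl) (simp add: algebra_simps)
      also have "\<dots> =
          quadratic_form n R x - (\<Sum>i<n. \<Sum>j<n. (cnj (x i) * R i m) * (R m j * x j)) / of_real a"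
        unfolding quadratic_form_def sum_divide_distrib by (simp only: sum_subtractf)
      also have "(\<Sum>i<n. \<Sum>j<n. (cnj (x i) * R i m) * (R m j * x j)) = cnj r * r"
        unfolding cr unfolding r_def sum_product ..
      \<comment> \<open>Completing the square: the form of \<open>R'\<close> at \<open>x\<close> is
        the form of \<open>R\<close> at \<open>x\<close> with coordinate \<open>m\<close> shifted by
        \<open>- r / a\<close>, so it inherits nonnegativity.\<close>
      also have "quadratic_form n R x - cnj r * r / of_real a =
          quadratic_form n R (\<lambda>i. x i + (if i = m then - r / of_real a else 0))"
        unfolding quadratic_form_perturb[OF hR m] r_def[symmetric] Rmm
        using a by (simp add: mult.commute)
      finally show ?thesis using pR by simp
    qed
    moreover have "R' i j = 0" if ij: "i < Suc m" "j < n" for i j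
    proof (cases "i = m")
      case True
      then show ?thesis using a by (simp add: R'_def Rmm)
    next
      case False
      then have "R i j = 0" "R i m = 0" using zR ij m by auto
      then show ?thesis by (simp add: R'_def)
    qed
    ultimately show ?thesis by blast
  qed
qed

lemma psd_factorization:
  assumes A: "A \<in> carrier_mat n n" and herm: "hermitian_mat A" and psd: "psd_mat A"
  obtains B where "\<And>i j. i < n \<Longrightarrow> j < n \<Longrightarrow> A $$ (i, j) = (\<Sum>a<n. B i a * cnj (B j a))"
proof -
  have h: "hermitian_on n (\<lambda>i j. A $$ (i, j))"
    unfolding hermitian_on_def
  proof (intro allI impI)
    fix i j assume "i < n" "j < n"
    then have "mat_adjoint A $$ (i, j) = cnj (A $$ (j, i))"
      using A by (intro index_mat_adjoint) auto
    then show "A $$ (i, j) = cnj (A $$ (j, i))" using herm by (simp add: hermitian_mat_def)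
  qed
  have p: "0 \<le> Re (quadratic_form n (\<lambda>i j. A $$ (i, j)) x)" for x
  proof -
    have "0 \<le> (A *\<^sub>v vec n x) \<bullet>c vec n x" using psd A by (simp add: psd_mat_def)
    moreover have "(A *\<^sub>v vec n x) \<bullet>c vec n x = quadratic_form n (\<lambda>i j. A $$ (i, j)) x"
      using A by (simp add: scalar_prod_def quadratic_form_def lessThan_atLeast0 sum_distrib_left
          sum_distrib_right mult_ac)
    ultimately show ?thesis by (simp add: less_eq_complex_def)
  qed
  show ?thesis
    using psd_partial_factorization[of n "\<lambda>i j. A $$ (i, j)" n, OF h p] that by auto
qed

text \<open>The columns of \<open>C\<close> are a maximal independent set of columns of
  \<open>A\<close>, of size \<open>r\<close>; \<open>D\<close> holds the coordinates of every column
  of \<open>A\<close> in this basis.\<close>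

lemma rank_factorization:
  assumes A: "(A :: complex mat) \<in> carrier_mat n m" and rank: "vec_space.rank n A = r"
  obtains C D where "C \<in> carrier_mat n r" "D \<in> carrier_mat r m" "A = C * D"
proof -
  interpret vec_space "TYPE(complex)" n .
  have cols: "set (cols A) \<subseteq> carrier_vec n" using A cols_dim by blast
  obtain U where max: "maximal U (\<lambda>T. T \<subseteq> set (cols A) \<and> lin_indpt T)" and finU: "finite U"
    using maximal_exists_superset[of "set (cols A)" "\<lambda>T. T \<subseteq> set (cols A) \<and> lin_indpt T" "{}"]
      by (auto simp: lin_dep_def)
  have U: "U \<subseteq> set (cols A)" "lin_indpt U" using max by (auto simp: maximal_def)
  have Uc: "U \<subseteq> carrier_vec n" using U cols by blast
  have cardU: "card U = r" using rank_card_indpt[OF A max] rank by simp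
  obtain us where us: "distinct us" "set us = U" using finite_distinct_list[OF finU] by blast
  have len: "length us = r" using us cardU distinct_card by fastforce
  define C where "C = mat_of_cols n us"
  have C: "C \<in> carrier_mat n r" using len by (auto simp: C_def)
  have colsC: "cols C = us" using us Uc by (simp add: C_def)
  have "\<exists>a. col A j = lincomb a U" if j: "j < m" for j
  proof -
    have cj: "col A j \<in> set (cols A)" using j A by (auto simp: cols_def)
    have "col A j \<in> span U"
    proof (rule ccontr)
      assume notin: "col A j \<notin> span U"
      then have "lin_indpt (U \<union> {col A j})"
        using lin_dep_iff_in_span[OF Uc U(2), of "col A j"] cj cols span_mem[OF Uc] by blast
      then have "U \<union> {col A j} = U"
        using max cj U unfolding maximal_def by blast
      then show False using notin span_mem[OF Uc] by blast
    qed
    from finite_in_span[OF finU _ this] Uc obtain a where "lincomb a U = col A j" by auto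
    then show ?thesis by metis
  qed
  then obtain a where a: "\<And>j. j < m \<Longrightarrow> col A j = lincomb (a j) U" by metis
  define D where "D = mat r m (\<lambda>(i, j). a j (us ! i))"
  have D: "D \<in> carrier_mat r m" by (simp add: D_def)
  have "A = C * D"
  proof (rule mat_col_eqI)
    fix j assume "j < dim_col (C * D)"
    then have j: "j < m" using D by simp
    have "C *\<^sub>v vec r (\<lambda>i. a j (col C i)) = lincomb (a j) U"
      using mat_mult_eq_lincomb[OF C, of "a j"] us colsC by simp
    moreover have "col C i = us ! i" if "i < r" for i
      using that C colsC cols_nth[of i C] by simp
    then have "vec r (\<lambda>i. a j (col C i)) = col D j"
      using j by (intro eq_vecI) (auto simp: D_def)
    ultimately show "col A j = col (C * D) j"
      using a[OF j] col_mult2[OF C D j] by simp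
  qed (use A C D in auto)
  then show ?thesis using that C D by blast
qed

text \<open>Used to unpack the flattened indices of block, Kronecker and stacked objects, where
  quotient and remainder carry two independent indices.\<close>

lemma sum_lessThan_mult:
  fixes f :: "nat \<Rightarrow> nat \<Rightarrow> 'a :: comm_monoid_add"
  shows "(\<Sum>q<m * n. f (q div n) (q mod n)) = (\<Sum>a<m. \<Sum>b<n. f a b)"
proof -
  have "(\<Sum>q<m * n. f (q div n) (q mod n)) =
      (\<Sum>a<m. \<Sum>q\<in>{a * n..<a * n + n}. f (q div n) (q mod n))"
    by (simp add: sum.nat_group)
  also have "\<dots> = (\<Sum>a<m. \<Sum>b<n. f a b)"
  proof (rule sum.cong[OF refl])
    fix a
    have "(\<Sum>q\<in>{a * n..<a * n + n}. f (q div n) (q mod n)) =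
        (\<Sum>b\<in>{0..<n}. f ((b + a * n) div n) ((b + a * n) mod n))"
      using sum.shift_bounds_nat_ivl[of "\<lambda>q. f (q div n) (q mod n)" 0 "a * n" n]
      by (simp add: add.commute)
    then show "(\<Sum>q\<in>{a * n..<a * n + n}. f (q div n) (q mod n)) = (\<Sum>b<n. f a b)"
      by (simp add: lessThan_atLeast0)
  qed
  finally show ?thesis .
qed

subsection \<open>The kernel of \<open>W\<close>\<close>

lemma sub_mod_less: "0 < L \<Longrightarrow> sub_mod L a b < L"
  by (simp add: sub_mod_def nat_less_iff)

lemma int_sub_mod: "0 < L \<Longrightarrow> int (sub_mod L a b) = (int a - int b) mod int L"
  by (simp add: sub_mod_def)

text \<open>Equal shifts of row and column stay on the same circular diagonal; this is why circulant
  phases cancel in \<open>H_mat L X i i\<close>.\<close>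

lemma sub_mod_sub_mod_same:
  assumes "0 < L"
  shows "sub_mod L (sub_mod L a c) (sub_mod L b c) = sub_mod L a b"
proof -
  have "int (sub_mod L (sub_mod L a c) (sub_mod L b c)) = int (sub_mod L a b)"
    using assms by (simp add: int_sub_mod mod_simps)
  then show ?thesis by simp
qed

text \<open>One extra shift of the column lowers the circular diagonal by one; this is why
  \<open>H_mat L X i (i + 1)\<close> sees ratios of neighbouring phases.\<close>

lemma sub_mod_sub_mod_Suc:
  assumes "0 < L"
  shows "sub_mod L (sub_mod L a (c + 1)) (sub_mod L b c) = sub_mod L (sub_mod L a b) 1"
proof -
  have "int (sub_mod L (sub_mod L a (c + 1)) (sub_mod L b c)) = int (sub_mod L (sub_mod L a b) 1)"
    using assms mod_diff_eq[of "int a - int (c + 1)" "int L" "int b - int c"]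
      mod_diff_left_eq[of "int a - int b" "int L" 1]
    by (simp add: int_sub_mod algebra_simps)
  then show ?thesis by simp
qed

lemma sub_mod_mod_right:
  assumes "0 < L"
  shows "sub_mod L a (b mod L) = sub_mod L a b"
proof -
  have "int (sub_mod L a (b mod L)) = int (sub_mod L a b)"
    using assms by (simp add: int_sub_mod zmod_int mod_simps)
  then show ?thesis by simp
qed

section \<open>Sizes and entries of the blocks of \<open>W\<close>\<close>

lemma index_H_mat:
  assumes "X \<in> carrier_mat L L" "k < L" "l < L"
  shows "H_mat L X i j $$ (k, l) = X $$ (k, l) * cnj (X $$ (sub_mod L k i, sub_mod L l j))"
  using assms by (simp add: H_mat_def hadamard_mat_def conj_mat_def shift_mat_def)

lemma H_mat_carrier: "X \<in> carrier_mat L L \<Longrightarrow> H_mat L X i j \<in> carrier_mat L L"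
  by (auto simp: H_mat_def hadamard_mat_def)

lemma diag_block_mat_uniform_carrier:
  assumes "\<And>A. A \<in> set As \<Longrightarrow> A \<in> carrier_mat m n"
  shows "diag_block_mat As \<in> carrier_mat (length As * m) (length As * n)"
  using assms
proof (induction As)
  case (Cons A As)
  then have "diag_block_mat As \<in> carrier_mat (length As * m) (length As * n)" "A \<in> carrier_mat m n"
    by auto
  then show ?case by (auto simp: Let_def)
qed simp

lemma index_diag_block_mat_uniform:
  assumes "\<And>A. A \<in> set As \<Longrightarrow> A \<in> carrier_mat m n"
    and "i < length As * m" "j < length As * n"
  shows "diag_block_mat As $$ (i, j) =
    (if i div m = j div n then (As ! (i div m)) $$ (i mod m, j mod n) else 0)"
  using assms
proof (induction As arbitrary: i j)
  case (Cons A As)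
  have m: "0 < m" and n: "0 < n" using Cons.prems(2,3) by (auto intro: gr0I)
  have A: "dim_row A = m" "dim_col A = n" using Cons.prems(1)[of A] by auto
  have D: "dim_row (diag_block_mat As) = length As * m" "dim_col (diag_block_mat As) = length As * n"
    using diag_block_mat_uniform_carrier[of As m n] Cons.prems(1) by auto
  have ij: "i < m + length As * m" "j < n + length As * n" using Cons.prems by auto
  have IH: "diag_block_mat As $$ (i - m, j - n) = (if (i - m) div m = (j - n) div n
      then (As ! ((i - m) div m)) $$ ((i - m) mod m, (j - n) mod n) else 0)"
    if "m \<le> i" "n \<le> j"
    using that ij Cons.prems(1) by (intro Cons.IH) auto
  show ?case
    using ij A D m n IH
    by (cases "i < m"; cases "j < n") (auto simp: Let_def le_div_geq le_mod_geq not_less)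
qed simp

lemma kronecker_carrier:
  "A \<in> carrier_mat m n \<Longrightarrow> B \<in> carrier_mat m' n' \<Longrightarrow> kronecker A B \<in> carrier_mat (m * m') (n * n')"
  by (auto simp: kronecker_def)

lemma index_Z_mat:
  assumes "V i \<in> carrier_mat L p" "V ((i + 1) mod L) \<in> carrier_mat L p" "q < L * L" "s < p * p"
  shows "Z_mat L V i $$ (q, s) =
    cnj (V ((i + 1) mod L) $$ (q div L, s div p)) * V i $$ (q mod L, s mod p)"
proof -
  have "q div L < L" "s div p < p" using assms(3,4) by (simp_all add: less_mult_imp_div_less)
  then show ?thesis using assms by (simp add: Z_mat_def kronecker_def conj_mat_def)
qed

lemma Z_mat_carrier:
  assumes "V i \<in> carrier_mat L p" "V ((i + 1) mod L) \<in> carrier_mat L p"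
  shows "Z_mat L V i \<in> carrier_mat (L * L) (p * p)"
  unfolding Z_mat_def using assms by (intro kronecker_carrier) (auto simp: conj_mat_def)

text \<open>The circulant of a unit vector marks one circular diagonal, so each row of a block of
  \<open>M\<close> has a nonzero entry in at most one column. Multiplying by \<open>lam\<close> thus
  scales \<open>H_mat L X i (i + 1)\<close> diagonal by diagonal.\<close>

lemma index_M_vec:
  assumes X: "X \<in> carrier_mat L L" and "q < L * L" "m < L"
  shows "M_vec L X i m $ q = (if m = sub_mod L (q div L) (q mod L)
    then H_mat L X i (i + 1) $$ (q mod L, q div L) else 0)"
proof -
  have L: "0 < L" using assms by (auto intro: gr0I)
  have "q div L < L" using assms by (simp add: less_mult_imp_div_less)
  then show ?thesis
    using assms L H_mat_carrier[OF X, of i "i + 1"] sub_mod_less[OF L, of "q div L" "q mod L"]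
    by (auto simp: M_vec_def hadamard_vec_def vec_of_mat_def circulant_def unit_vec_def)
qed

lemma diag_block_Z_mat_carrier:
  assumes V: "\<And>i. i < L \<Longrightarrow> V i \<in> carrier_mat L p"
  shows "diag_block_mat (map (Z_mat L V) [0..<L]) \<in> carrier_mat (L * (L * L)) (L * (p * p))"
proof -
  have "Z_mat L V i \<in> carrier_mat (L * L) (p * p)" if "i < L" for i
    using that by (intro Z_mat_carrier V) auto
  then have "diag_block_mat (map (Z_mat L V) [0..<L]) \<in>
      carrier_mat (length (map (Z_mat L V) [0..<L]) * (L * L)) (length (map (Z_mat L V) [0..<L]) * (p * p))"
    by (intro diag_block_mat_uniform_carrier) auto
  then show ?thesis by simp
qed

lemma M_mat_carrier: "M_mat L X \<in> carrier_mat (L * (L * L)) L"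
  by (simp add: M_mat_def power3_eq_cube mult.assoc)

lemma W_mat_carrier:
  assumes "\<And>i. i < L \<Longrightarrow> V i \<in> carrier_mat L p"
  shows "W_mat L X V \<in> carrier_mat (L * (L * L)) (L + L * (p * p))"
  using diag_block_Z_mat_carrier[of L V p] M_mat_carrier[of L X] assms
  by (auto simp: W_mat_def Let_def)

text \<open>Block row \<open>i\<close> of \<open>W w = 0\<close> is the stacked form of a matrix
  equation: a Kronecker product of \<open>conj B\<close> and \<open>A\<close> sends the stacking of
  \<open>G\<close> to that of \<open>A G B^*\<close>, here with \<open>A\<close> and
  \<open>B\<close> the consecutive eigenvector matrices.\<close>

lemma W_mat_kernelI:
  assumes L: "0 < L" and X: "X \<in> carrier_mat L L"
    and V: "\<And>i. i < L \<Longrightarrow> V i \<in> carrier_mat L p"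
    and eq: "\<And>i k l. i < L \<Longrightarrow> k < L \<Longrightarrow> l < L \<Longrightarrow>
      H_mat L X i (i + 1) $$ (k, l) * lam (sub_mod L l k) =
      (\<Sum>a<p. \<Sum>b<p. cnj (V ((i + 1) mod L) $$ (l, a)) * V i $$ (k, b) * G i b a)"
  shows "W_mat L X V *\<^sub>v (vec L lam @\<^sub>v
      vec (L * (p * p)) (\<lambda>u. G (u div (p * p)) (u mod (p * p) mod p) (u mod (p * p) div p))) =
    0\<^sub>v (L * (L * L))"
proof -
  \<comment> \<open>The matrices \<open>G i\<close> stacked by columns, one after another: within a
    block the remainder modulo \<open>p\<close> is the row and the quotient is the column.\<close>
  define g where "g = (\<lambda>u. G (u div (p * p)) (u mod (p * p) mod p) (u mod (p * p) div p))"
  define D where "D = diag_block_mat (map (Z_mat L V) [0..<L])"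
  have Z: "Z_mat L V i \<in> carrier_mat (L * L) (p * p)" if "i < L" for i
    using that L V by (intro Z_mat_carrier) auto
  have M: "M_mat L X \<in> carrier_mat (L * (L * L)) L" by (rule M_mat_carrier)
  have D: "D \<in> carrier_mat (L * (L * L)) (L * (p * p))"
    unfolding D_def by (rule diag_block_Z_mat_carrier[OF V])
  have W: "W_mat L X V = four_block_mat (M_mat L X) (- D) (0\<^sub>m 0 L) (0\<^sub>m 0 (L * (p * p)))"
    using M D by (simp add: W_mat_def Let_def flip: D_def)
  have "W_mat L X V *\<^sub>v (vec L lam @\<^sub>v vec (L * (p * p)) g) =
      (M_mat L X *\<^sub>v vec L lam + - D *\<^sub>v vec (L * (p * p)) g) @\<^sub>v
      (0\<^sub>m 0 L *\<^sub>v vec L lam + 0\<^sub>m 0 (L * (p * p)) *\<^sub>v vec (L * (p * p)) g)"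
    unfolding W using M D
    by (intro four_block_mat_mult_vec[of _ "L * (L * L)" L _ "L * (p * p)" _ 0]) auto
  also have "\<dots> = 0\<^sub>v (L * (L * L))"
  proof (rule eq_vecI)
    fix \<rho> assume "\<rho> < dim_vec (0\<^sub>v (L * (L * L)) :: complex vec)"
    then have rho: "\<rho> < L * (L * L)" by simp
    define i q k l where "i = \<rho> div (L * L)" and "q = \<rho> mod (L * L)"
      and "k = q mod L" and "l = q div L"
    have i: "i < L" using rho by (simp add: i_def less_mult_imp_div_less)
    have q: "q < L * L" using L by (simp add: q_def)
    have k: "k < L" and l: "l < L" using L q by (simp_all add: k_def l_def less_mult_imp_div_less)
    have "(M_mat L X *\<^sub>v vec L lam) $ \<rho> = (\<Sum>m<L. M_vec L X i m $ q * lam m)"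
      unfolding index_mult_mat_vec_sum[OF M vec_carrier rho]
      using rho by (intro sum.cong refl)
        (simp add: M_mat_def i_def q_def power3_eq_cube power2_eq_square mult.assoc)
    also have "\<dots> = (\<Sum>m<L. if m = sub_mod L l k then H_mat L X i (i + 1) $$ (k, l) * lam m else 0)"
      by (intro sum.cong refl) (simp add: index_M_vec[OF X q] k_def l_def)
    also have "\<dots> = H_mat L X i (i + 1) $$ (k, l) * lam (sub_mod L l k)"
      using sub_mod_less[OF L, of l k] by simp
    finally have Ml: "(M_mat L X *\<^sub>v vec L lam) $ \<rho> =
        H_mat L X i (i + 1) $$ (k, l) * lam (sub_mod L l k)" .
    have "(D *\<^sub>v vec (L * (p * p)) g) $ \<rho> = (\<Sum>t<L * (p * p). D $$ (\<rho>, t) * g t)"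
      unfolding index_mult_mat_vec_sum[OF D vec_carrier rho] by simp
    also have "\<dots> = (\<Sum>t<L * (p * p). (if i = t div (p * p) then Z_mat L V i $$ (q, t mod (p * p)) *
        G i (t mod (p * p) mod p) (t mod (p * p) div p) else 0))"
    proof (intro sum.cong refl)
      fix t assume t: "t \<in> {..<L * (p * p)}"
      have "D $$ (\<rho>, t) = (if \<rho> div (L * L) = t div (p * p)
          then (map (Z_mat L V) [0..<L] ! (\<rho> div (L * L))) $$ (\<rho> mod (L * L), t mod (p * p)) else 0)"
        unfolding D_def
        by (rule index_diag_block_mat_uniform[of _ "L * L" "p * p"]) (use Z rho t in auto)
      then show "D $$ (\<rho>, t) * g t = (if i = t div (p * p) then Z_mat L V i $$ (q, t mod (p * p)) *
          G i (t mod (p * p) mod p) (t mod (p * p) div p) else 0)"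
        using i by (simp add: g_def flip: i_def q_def)
    qed
    also have "\<dots> = (\<Sum>j<L. \<Sum>s<p * p. if i = j then Z_mat L V i $$ (q, s) * G i (s mod p) (s div p) else 0)"
      by (rule sum_lessThan_mult[of "\<lambda>j s. if i = j then Z_mat L V i $$ (q, s) * G i (s mod p) (s div p) else 0"])
    also have "\<dots> = (\<Sum>j<L. if i = j then \<Sum>s<p * p. Z_mat L V i $$ (q, s) * G i (s mod p) (s div p) else 0)"
      by (intro sum.cong refl) simp
    also have "\<dots> = (\<Sum>s<p * p. Z_mat L V i $$ (q, s) * G i (s mod p) (s div p))"
      using i by simp
    also have "\<dots> = (\<Sum>s<p * p. cnj (V ((i + 1) mod L) $$ (l, s div p)) * V i $$ (k, s mod p)
        * G i (s mod p) (s div p))"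
      unfolding k_def l_def using index_Z_mat[of V i L p q, OF V[OF i] V q] L
      by (intro sum.cong refl) simp
    also have "\<dots> = (\<Sum>a<p. \<Sum>b<p. cnj (V ((i + 1) mod L) $$ (l, a)) * V i $$ (k, b) * G i b a)"
      by (rule sum_lessThan_mult[of "\<lambda>a b. cnj (V ((i + 1) mod L) $$ (l, a)) * V i $$ (k, b) * G i b a"])
    finally have Dg: "(D *\<^sub>v vec (L * (p * p)) g) $ \<rho> =
        H_mat L X i (i + 1) $$ (k, l) * lam (sub_mod L l k)"
      using eq[OF i k l] by simp
    have "(- D *\<^sub>v vec (L * (p * p)) g) $ \<rho> = - ((D *\<^sub>v vec (L * (p * p)) g) $ \<rho>)"
      using rho D by simp
    then show "((M_mat L X *\<^sub>v vec L lam + - D *\<^sub>v vec (L * (p * p)) g) @\<^sub>v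
      (0\<^sub>m 0 L *\<^sub>v vec L lam + 0\<^sub>m 0 (L * (p * p)) *\<^sub>v vec (L * (p * p)) g)) $ \<rho> =
      0\<^sub>v (L * (L * L)) $ \<rho>"
      using rho M D by (simp add: Ml Dg)
  qed (use M D in auto)
  finally show ?thesis unfolding g_def .
qed

section \<open>Circulant rephasings and the kernel vectors they produce\<close>

lemma index_phase_circulant:
  assumes "A \<in> carrier_mat L L" "k < L" "l < L"
  shows "phase_circulant L A \<theta> $$ (k, l) =
    A $$ (k, l) * (if sub_mod L l k = 0 then 1 else cis (\<theta> (sub_mod L l k)))"
  using assms sub_mod_less[of L l k]
  by (auto simp: phase_circulant_def hadamard_mat_def circulant_def)

lemma phase_circulant_carrier:
  "A \<in> carrier_mat L L \<Longrightarrow> phase_circulant L A \<theta> \<in> carrier_mat L L"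
  by (auto simp: phase_circulant_def hadamard_mat_def)

text \<open>From \<open>S = C D\<close> through dimension \<open>r\<close>, the entrywise product
  with a conjugated shift factors through pairs of inner indices, hence through dimension
  \<open>r\<^sup>2\<close>.\<close>

lemma nonzero_roots_H_mat_diagonal:
  assumes S: "S \<in> carrier_mat L L" and rank: "vec_space.rank L S = r"
  shows "size {#x \<in># proots (char_poly (H_mat L S i i)). x \<noteq> 0#} \<le> r\<^sup>2"
proof -
  obtain C D where C: "C \<in> carrier_mat L r" and D: "D \<in> carrier_mat r L" and SCD: "S = C * D"
    using rank_factorization[OF S rank] by blast
  define C' where "C' = mat L (r\<^sup>2) (\<lambda>(k, q). C $$ (k, q div r) * cnj (C $$ (sub_mod L k i, q mod r)))"
  define D' where "D' = mat (r\<^sup>2) L (\<lambda>(q, l). D $$ (q div r, l) * cnj (D $$ (q mod r, sub_mod L l i)))"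
  have carr: "C' \<in> carrier_mat L (r\<^sup>2)" "D' \<in> carrier_mat (r\<^sup>2) L" by (auto simp: C'_def D'_def)
  have "H_mat L S i i = C' * D'"
  proof (rule eq_matI)
    fix k l assume "k < dim_row (C' * D')" "l < dim_col (C' * D')"
    then have k: "k < L" and l: "l < L" using carr by auto
    have km: "sub_mod L k i < L" and lm: "sub_mod L l i < L" using k sub_mod_less by auto
    have "H_mat L S i i $$ (k, l) = (\<Sum>a<r. C $$ (k, a) * D $$ (a, l)) *
        cnj (\<Sum>b<r. C $$ (sub_mod L k i, b) * D $$ (b, sub_mod L l i))"
      unfolding index_H_mat[OF S k l] unfolding SCD
      by (simp only: index_mult_mat_sum[OF C D k l] index_mult_mat_sum[OF C D km lm])
    also have "\<dots> = (\<Sum>a<r. \<Sum>b<r. C $$ (k, a) * cnj (C $$ (sub_mod L k i, b)) *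
        (D $$ (a, l) * cnj (D $$ (b, sub_mod L l i))))"
      by (simp add: sum_product mult_ac)
    also have "\<dots> = (\<Sum>q<r * r. C $$ (k, q div r) * cnj (C $$ (sub_mod L k i, q mod r)) *
        (D $$ (q div r, l) * cnj (D $$ (q mod r, sub_mod L l i))))"
      by (rule sum_lessThan_mult[symmetric, of "\<lambda>a b. C $$ (k, a) * cnj (C $$ (sub_mod L k i, b)) *
        (D $$ (a, l) * cnj (D $$ (b, sub_mod L l i)))"])
    also have "\<dots> = (C' * D') $$ (k, l)"
      unfolding index_mult_mat_sum[OF carr k l] using k l
      by (intro sum.cong) (simp_all add: C'_def D'_def power2_eq_square)
    finally show "H_mat L S i i $$ (k, l) = (C' * D') $$ (k, l)" .
  qed (use carr H_mat_carrier[OF S, of i i] in auto)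
  then show ?thesis using size_nonzero_roots_le[OF carr] by simp
qed

text \<open>Both factors lie on the same circular diagonal, so each phase meets its own conjugate.
  The known \<open>X\<close> and an unknown rephasing therefore share their top
  eigenvectors.\<close>

lemma H_mat_diagonal_rephase:
  assumes L: "0 < L" and S: "S \<in> carrier_mat L L" and X: "X \<in> carrier_mat L L"
    and eq: "\<And>k l. k < L \<Longrightarrow> l < L \<Longrightarrow> X $$ (k, l) = S $$ (k, l) * \<chi> (sub_mod L l k)"
    and unit: "\<And>m. \<chi> m * cnj (\<chi> m) = 1"
  shows "H_mat L X i i = H_mat L S i i"
proof (rule eq_matI)
  fix k l assume "k < dim_row (H_mat L S i i)" "l < dim_col (H_mat L S i i)"
  then have k: "k < L" and l: "l < L" using H_mat_carrier[OF S, of i i] by auto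
  have "X $$ (k, l) * cnj (X $$ (sub_mod L k i, sub_mod L l i)) =
      S $$ (k, l) * cnj (S $$ (sub_mod L k i, sub_mod L l i)) *
      (\<chi> (sub_mod L l k) * cnj (\<chi> (sub_mod L l k)))"
    using k l by (simp add: eq sub_mod_less[OF L] sub_mod_sub_mod_same[OF L])
  then show "H_mat L X i i $$ (k, l) = H_mat L S i i $$ (k, l)"
    unfolding index_H_mat[OF X k l] index_H_mat[OF S k l] unit by simp
qed (use H_mat_carrier[OF X, of i i] H_mat_carrier[OF S, of i i] in auto)

text \<open>Both \<open>X\<close> and \<open>T\<close> are taken relative to \<open>S\<close>, so
  that the lemma applies to \<open>T = S\<close> with all phases 1 as well as to a candidate
  rephasing.\<close>

lemma psd_rephasing_W_kernel:
  assumes L: "0 < L" and S: "S \<in> carrier_mat L L"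
    and X: "X \<in> carrier_mat L L"
      "\<And>k l. k < L \<Longrightarrow> l < L \<Longrightarrow> X $$ (k, l) = S $$ (k, l) * \<chi> (sub_mod L l k)"
    and T: "T \<in> carrier_mat L L" "hermitian_mat T" "psd_mat T"
      "\<And>k l. k < L \<Longrightarrow> l < L \<Longrightarrow> T $$ (k, l) = S $$ (k, l) * \<gamma> (sub_mod L l k)"
    and unit: "\<And>m. \<chi> m * cnj (\<chi> m) = 1" "\<And>m. \<gamma> m * cnj (\<gamma> m) = 1"
    and V: "\<And>i. i < L \<Longrightarrow> top_eigenvectors p (H_mat L X i i) (V i)"
    and nonzero: "\<And>i. i < L \<Longrightarrow> size {#x \<in># proots (char_poly (H_mat L X i i)). x \<noteq> 0#} \<le> p"
  shows "\<exists>w \<in> carrier_vec (L + L * (p * p)). W_mat L X V *\<^sub>v w = 0\<^sub>v (L * (L * L)) \<and>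
    (\<forall>m<L. w $ m = (\<gamma> m * cnj (\<chi> m)) * cnj (\<gamma> (sub_mod L m 1) * cnj (\<chi> (sub_mod L m 1))))"
proof -
  obtain B where B: "\<And>k l. k < L \<Longrightarrow> l < L \<Longrightarrow> T $$ (k, l) = (\<Sum>a<L. B k a * cnj (B l a))"
    using psd_factorization[OF T(1-3)] by blast
  \<comment> \<open>Row-wise products of \<open>B\<close> with its conjugated shift;
    \<open>q\<close> encodes a pair of columns of \<open>B\<close>.\<close>
  define E where "E = (\<lambda>i k q. B k (q div L) * cnj (B (sub_mod L k i) (q mod L)))"
  have HT: "H_mat L T i j $$ (k, l) = (\<Sum>q<L * L. E i k q * cnj (E j l q))"
    if k: "k < L" and l: "l < L" for i j k l
  proof -
    have "H_mat L T i j $$ (k, l) = (\<Sum>a<L. B k a * cnj (B l a)) *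
        cnj (\<Sum>b<L. B (sub_mod L k i) b * cnj (B (sub_mod L l j) b))"
      using B sub_mod_less[OF L] k l by (simp only: index_H_mat[OF T(1)])
    also have "\<dots> = (\<Sum>a<L. \<Sum>b<L. B k a * cnj (B (sub_mod L k i) b) *
        cnj (B l a * cnj (B (sub_mod L l j) b)))"
      by (simp add: sum_product mult_ac)
    also have "\<dots> = (\<Sum>q<L * L. E i k q * cnj (E j l q))"
      unfolding E_def
      by (rule sum_lessThan_mult[symmetric, of "\<lambda>a b. B k a * cnj (B (sub_mod L k i) b) *
        cnj (B l a * cnj (B (sub_mod L l j) b))"])
    finally show ?thesis .
  qed
  have same: "H_mat L X i i $$ (k, l) = (\<Sum>q<L * L. E i k q * cnj (E i l q))"
    if k: "k < L" and l: "l < L" for i k l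
    using HT[OF k l, of i i] H_mat_diagonal_rephase[OF L S X unit(1)]
      H_mat_diagonal_rephase[OF L S T(1,4) unit(2)] by simp
  have Vc: "V i \<in> carrier_mat L p" if "i < L" for i
    using V[OF that] H_mat_carrier[OF X(1), of i i] by (simp add: top_eigenvectors_def)
  define d where "d = (\<lambda>i b q. \<Sum>l<L. E i l q * cnj (V i $$ (l, b)))"
  \<comment> \<open>The factor \<open>E\<close> comes from \<open>T\<close>, the eigenvectors from
    \<open>X\<close>; the projection lemma applies because the diagonal products agree.\<close>
  have proj: "E i k q = (\<Sum>b<p. d i b q * V i $$ (k, b))" if "i < L" "k < L" "q < L * L" for i k q
    unfolding d_def
    by (rule sym, rule top_eigenvectors_project[OF H_mat_carrier[OF X(1)] V[OF that(1)] same _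
        nonzero[OF that(1)] that(2)]) (use that in auto)
  define lam where "lam = (\<lambda>m. (\<gamma> m * cnj (\<chi> m)) * cnj (\<gamma> (sub_mod L m 1) * cnj (\<chi> (sub_mod L m 1))))"
  define G where "G = (\<lambda>i b a. \<Sum>q<L * L. d i b q * cnj (d ((i + 1) mod L) a q))"
  define w where "w = vec L lam @\<^sub>v
      vec (L * (p * p)) (\<lambda>u. G (u div (p * p)) (u mod (p * p) mod p) (u mod (p * p) div p))"
  have "W_mat L X V *\<^sub>v w = 0\<^sub>v (L * (L * L))"
    unfolding w_def
  proof (rule W_mat_kernelI[OF L X(1) Vc])
    fix i k l assume i: "i < L" and k: "k < L" and l: "l < L"
    define j where "j = (i + 1) mod L"
    define m where "m = sub_mod L l k"
    have j: "j < L" using L by (simp add: j_def)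
    \<comment> \<open>For \<open>i = L - 1\<close> the shift is by \<open>L\<close>, while the
      eigenvector matrix used is \<open>V 0\<close>.\<close>
    have E_Suc: "E (i + 1) l = E j l" by (simp only: E_def j_def sub_mod_mod_right[OF L])
    have idx: "sub_mod L (sub_mod L l (i + 1)) (sub_mod L k i) = sub_mod L m 1"
      unfolding m_def by (rule sub_mod_sub_mod_Suc[OF L])
    have "H_mat L X i (i + 1) $$ (k, l) * lam m =
        S $$ (k, l) * cnj (S $$ (sub_mod L k i, sub_mod L l (i + 1))) * \<gamma> m * cnj (\<gamma> (sub_mod L m 1)) *
        (\<chi> m * cnj (\<chi> m)) * (\<chi> (sub_mod L m 1) * cnj (\<chi> (sub_mod L m 1)))"
      unfolding index_H_mat[OF X(1) k l] X(2)[OF k l] X(2)[OF sub_mod_less[OF L] sub_mod_less[OF L]]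
        idx m_def[symmetric] lam_def by (simp add: mult_ac)
    also have "\<dots> = H_mat L T i (i + 1) $$ (k, l)"
      unfolding index_H_mat[OF T(1) k l] T(4)[OF k l] T(4)[OF sub_mod_less[OF L] sub_mod_less[OF L]]
        idx m_def[symmetric] unit by (simp add: mult_ac)
    also have "\<dots> = (\<Sum>q<L * L. E i k q * cnj (E j l q))"
      unfolding HT[OF k l] E_Suc ..
    also have "\<dots> = (\<Sum>q<L * L. (\<Sum>b<p. d i b q * V i $$ (k, b)) * cnj (\<Sum>a<p. d j a q * V j $$ (l, a)))"
      by (intro sum.cong refl) (simp add: proj i j k l)
    also have "\<dots> = (\<Sum>q<L * L. \<Sum>a<p. \<Sum>b<p. cnj (V j $$ (l, a)) * V i $$ (k, b) * (d i b q * cnj (d j a q)))"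
      unfolding cnj_sum sum_product by (subst sum.swap) (simp add: mult_ac)
    also have "\<dots> = (\<Sum>a<p. \<Sum>q<L * L. \<Sum>b<p. cnj (V j $$ (l, a)) * V i $$ (k, b) * (d i b q * cnj (d j a q)))"
      by (rule sum.swap)
    also have "\<dots> = (\<Sum>a<p. \<Sum>b<p. \<Sum>q<L * L. cnj (V j $$ (l, a)) * V i $$ (k, b) * (d i b q * cnj (d j a q)))"
      by (intro sum.cong refl sum.swap)
    also have "\<dots> = (\<Sum>a<p. \<Sum>b<p. cnj (V j $$ (l, a)) * V i $$ (k, b) * G i b a)"
      by (simp add: G_def j_def sum_distrib_left)
    finally show "H_mat L X i (i + 1) $$ (k, l) * lam (sub_mod L l k) =
        (\<Sum>a<p. \<Sum>b<p. cnj (V ((i + 1) mod L) $$ (l, a)) * V i $$ (k, b) * G i b a)"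
      unfolding m_def j_def .
  qed
  moreover have "w \<in> carrier_vec (L + L * (p * p))" by (simp add: w_def)
  moreover have "\<forall>m<L. w $ m = lam m" by (simp add: w_def)
  ultimately show ?thesis unfolding lam_def by blast
qed

subsection \<open>The orbit \<open>Omega\<close> and the phases\<close>

lemma power_mod_root_of_unity:
  fixes c :: "'a :: monoid_mult"
  assumes "c ^ L = 1"
  shows "c ^ (n mod L) = c ^ n"
proof -
  have "c ^ n = c ^ (L * (n div L) + n mod L)" by simp
  also have "\<dots> = c ^ (n mod L)" unfolding power_add power_mult assms by simp
  finally show ?thesis ..
qed

lemma root_of_unity_norm:
  fixes c :: complex
  assumes L: "0 < L" and c: "c ^ L = 1"
  shows "c * cnj c = 1"
proof -
  have "cmod c ^ L = 1" using c by (metis norm_one norm_power)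
  then have "cmod c = 1" using L power_eq_imp_eq_base[of "cmod c" L 1] by simp
  then show ?thesis by (simp flip: complex_norm_square)
qed

lemma power_sub_mod_root_of_unity:
  fixes c :: complex
  assumes L: "0 < L" and c: "c ^ L = 1" and m: "m < L"
  shows "c ^ sub_mod L m k = c ^ m * cnj (c ^ k)"
proof -
  have "int ((sub_mod L m k + k) mod L) = int m"
    using L m by (simp add: zmod_int int_sub_mod mod_simps)
  then have "(sub_mod L m k + k) mod L = m" by simp
  then have "c ^ (sub_mod L m k + k) = c ^ m"
    using power_mod_root_of_unity[OF c, of "sub_mod L m k + k"] by simp
  then have "c ^ m * cnj (c ^ k) = c ^ sub_mod L m k * (c * cnj c) ^ k"
    by (simp add: power_add power_mult_distrib flip: mult.assoc)
  then show ?thesis by (simp add: root_of_unity_norm[OF L c])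
qed

lemma index_dft_vec:
  assumes "k < L"
  shows "dft_vec L l $ k = cnj (cis (2 * pi * real l / real L) ^ k)"
proof -
  have "exp (- \<i> * 2 * of_real pi * of_nat k * of_nat l / of_nat L :: complex) =
      cis (- (real k * (2 * pi * real l / real L)))"
    by (simp add: cis_conv_exp mult_ac)
  then show ?thesis using assms by (simp add: dft_vec_def DeMoivre cis_cnj)
qed

lemma cis_root_of_unity: "0 < L \<Longrightarrow> cis (2 * pi * real l / real L) ^ L = 1"
  using cis_multiple_2pi[of "real l"] by (simp add: DeMoivre)

text \<open>Conjugating by a Fourier vector multiplies circular diagonal \<open>m\<close> by
  \<open>c ^ m\<close> with \<open>c = cis (2 * pi * l / L)\<close>, and these \<open>c\<close> are
  exactly the roots of unity of order dividing \<open>L\<close>. Membership thus amounts to finding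
  one root \<open>c\<close>.\<close>

lemma Omega_eq:
  assumes L: "0 < L" and S: "S \<in> carrier_mat L L"
  shows "Omega L S = {mat L L (\<lambda>(k, m). S $$ (k, m) * c ^ sub_mod L m k) | c. c ^ L = 1}"
proof -
  define R where "R = (\<lambda>c. mat L L (\<lambda>(k, m). S $$ (k, m) * c ^ sub_mod L m k))"
  have el: "mat_diag L (($) (dft_vec L l)) * S * mat_diag L (($) (conjugate (dft_vec L l))) =
      R (cis (2 * pi * real l / real L))" for l
  proof -
    define c where "c = cis (2 * pi * real l / real L)"
    have c: "c ^ L = 1" unfolding c_def by (rule cis_root_of_unity[OF L])
    have "mat_diag L (($) (dft_vec L l)) * S * mat_diag L (($) (conjugate (dft_vec L l))) =
        mat L L (\<lambda>(k, m). dft_vec L l $ k * S $$ (k, m) * conjugate (dft_vec L l) $ m)"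
      using S by (subst mat_diag_mult_left[OF S], subst mat_diag_mult_right[of _ L])
        (auto intro!: eq_matI)
    also have "\<dots> = R c"
      unfolding R_def
    proof (rule eq_matI)
      fix k m assume "k < dim_row (mat L L (\<lambda>(k, m). S $$ (k, m) * c ^ sub_mod L m k))"
        "m < dim_col (mat L L (\<lambda>(k, m). S $$ (k, m) * c ^ sub_mod L m k))"
      then have km: "k < L" "m < L" by auto
      have "conjugate (dft_vec L l) $ m = c ^ m"
        using km index_dft_vec[OF km(2), of l] by (simp add: c_def dft_vec_def)
      then show "mat L L (\<lambda>(k, m). dft_vec L l $ k * S $$ (k, m) * conjugate (dft_vec L l) $ m) $$ (k, m) =
          mat L L (\<lambda>(k, m). S $$ (k, m) * c ^ sub_mod L m k) $$ (k, m)"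
        using km by (simp add: index_dft_vec power_sub_mod_root_of_unity[OF L c] flip: c_def)
    qed auto
    finally show ?thesis unfolding c_def .
  qed
  have "Omega L S = {R (cis (2 * pi * real l / real L)) | l. l < L}"
    unfolding Omega_def el ..
  also have "\<dots> = R ` ((\<lambda>l. cis (2 * pi * real l / real L)) ` {..<L})" by auto
  also have "(\<lambda>l. cis (2 * pi * real l / real L)) ` {..<L} = {c. c ^ L = 1}"
    using bij_betw_imp_surj_on[OF bij_betw_roots_unity[OF L]] .
  finally show ?thesis by (auto simp: R_def)
qed

text \<open>The phases \<open>c ^ k\<close> act as a unitary diagonal congruence and can be absorbed
  into the test vector.\<close>

lemma Omega_hermitian_psd:
  assumes L: "0 < L" and S: "S \<in> carrier_mat L L" "hermitian_mat S" "psd_mat S"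
    and T: "T \<in> Omega L S"
  shows "hermitian_mat T" "psd_mat T"
proof -
  obtain c where T: "T = mat L L (\<lambda>(k, m). S $$ (k, m) * c ^ sub_mod L m k)" and c: "c ^ L = 1"
    using T unfolding Omega_eq[OF L S(1)] by blast
  have Tc: "T \<in> carrier_mat L L" by (simp add: T)
  have T_idx: "T $$ (k, m) = cnj (c ^ k) * S $$ (k, m) * c ^ m" if "k < L" "m < L" for k m
    using that by (simp add: T power_sub_mod_root_of_unity[OF L c] mult_ac)
  have S_idx: "S $$ (k, m) = cnj (S $$ (m, k))" if "k < L" "m < L" for k m
    using that S(1,2) index_mat_adjoint[of k S m] unfolding hermitian_mat_def by simp
  have "mat_adjoint T = T"
  proof (rule eq_matI)
    fix k m assume "k < dim_row T" "m < dim_col T"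
    then have km: "k < L" "m < L" using Tc by auto
    have "mat_adjoint T $$ (k, m) = cnj (T $$ (m, k))"
      using km Tc by (intro index_mat_adjoint) auto
    also have "\<dots> = T $$ (k, m)"
      unfolding T_idx[OF km] T_idx[OF km(2,1)] S_idx[OF km] by (simp add: mult_ac)
    finally show "mat_adjoint T $$ (k, m) = T $$ (k, m)" .
  qed (use Tc in \<open>auto simp: mat_adjoint_def\<close>)
  then show "hermitian_mat T" using Tc by (simp add: hermitian_mat_def)
  show "psd_mat T"
    unfolding psd_mat_def
  proof (intro conjI ballI)
    fix v :: "complex vec" assume "v \<in> carrier_vec (dim_row T)"
    then have v: "v \<in> carrier_vec L" using Tc by simp
    define u where "u = vec L (\<lambda>k. c ^ k * v $ k)"
    have "(T *\<^sub>v v) \<bullet>c v = (\<Sum>k<L. (\<Sum>m<L. T $$ (k, m) * v $ m) * cnj (v $ k))"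
      using v Tc by (simp add: scalar_prod_def lessThan_atLeast0)
    also have "\<dots> = (\<Sum>k<L. (\<Sum>m<L. S $$ (k, m) * u $ m) * cnj (u $ k))"
      by (intro sum.cong refl) (simp add: T_idx u_def sum_distrib_left sum_distrib_right mult_ac)
    also have "\<dots> = (S *\<^sub>v u) \<bullet>c u"
      using S(1) by (simp add: scalar_prod_def lessThan_atLeast0 u_def)
    finally show "0 \<le> (T *\<^sub>v v) \<bullet>c v" using S(1,3) by (simp add: psd_mat_def u_def)
  qed (use Tc in simp)
qed

lemma sub_mod_one:
  assumes "m < L"
  shows "sub_mod L m (Suc 0) = (if m = 0 then L - 1 else m - 1)"
proof -
  have "(int m - 1) mod int L = (if m = 0 then int L - 1 else int m - 1)"
    using assms by (auto simp: zmod_minus1)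
  then show ?thesis using assms by (auto simp: sub_mod_def)
qed

text \<open>The ratios telescope from \<open>\<gamma> 0 = 1\<close> to \<open>c ^ m\<close>; the
  ratio at index 0 wraps around to \<open>L - 1\<close> and closes the cycle, which forces
  \<open>c ^ L = 1\<close>.\<close>

lemma constant_ratio_power:
  fixes \<gamma> :: "nat \<Rightarrow> complex"
  assumes L: "0 < L" and unit: "\<And>m. \<gamma> m * cnj (\<gamma> m) = 1" and "\<gamma> 0 = 1"
    and ratio: "\<And>m. m < L \<Longrightarrow> \<gamma> m * cnj (\<gamma> (sub_mod L m 1)) = c"
  shows "m < L \<Longrightarrow> \<gamma> m = c ^ m" and "c ^ L = 1"
proof -
  have step: "\<gamma> m = c * \<gamma> (sub_mod L m 1)" if "m < L" for m
    using ratio[OF that] unit[of "sub_mod L m 1"]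
    by (metis mult.assoc mult.commute mult.right_neutral)
  have pow: "m < L \<longrightarrow> \<gamma> m = c ^ m" for m
  proof (induction m)
    case (Suc m)
    show ?case
    proof
      assume m: "Suc m < L"
      have "\<gamma> (Suc m) = c * \<gamma> m" using step[OF m] m by (simp add: sub_mod_one)
      then show "\<gamma> (Suc m) = c ^ Suc m" using Suc m by simp
    qed
  qed (simp add: \<open>\<gamma> 0 = 1\<close>)
  then show "m < L \<Longrightarrow> \<gamma> m = c ^ m" by blast
  have "1 = c * c ^ (L - 1)"
    using step[OF L] pow[of "L - 1"] L \<open>\<gamma> 0 = 1\<close> by (simp add: sub_mod_one)
  then show "c ^ L = 1" using L by (simp flip: power_Suc)
qed

theorem proposition12:
  fixes L r :: nat
    and S X W :: "complex mat"
    and \<phi> :: "nat \<Rightarrow> real"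
    and V :: "nat \<Rightarrow> complex mat"
  assumes S_carrier: "S \<in> carrier_mat L L"
    and S_hermitian: "hermitian_mat S"
    and S_psd: "psd_mat S"
    and S_rank: "vec_space.rank L S = r"
    and r_less: "real r < sqrt (real L)"
    and phi: "\<forall>m \<in> {1..<L}. 0 \<le> \<phi> m \<and> \<phi> m < 2 * pi"
    and X: "X = phase_circulant L S \<phi>"
    and V: "\<forall>i < L. top_eigenvectors (r\<^sup>2) (H_mat L X i i) (V i)"
    and W: "W = W_mat L X V"
    and second_smallest: "1 < length (singular_values W)" "singular_values W ! 1 > 0"
  shows "(\<forall>\<psi> :: nat \<Rightarrow> real.
            let Xt = phase_circulant L X (\<lambda>m. - \<psi> m)
            in hermitian_mat Xt \<and> psd_mat Xt \<longleftrightarrow> Xt \<in> Omega L S) \<and>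
         (\<forall>(v :: complex vec) (k :: nat) (\<psi> :: nat \<Rightarrow> real).
            right_singular_vector W (singular_values W ! 0) v \<and> k < L \<and>
            (\<forall>m \<in> {1..<L}.
               [\<psi> m = - (\<Sum>l = 1..m. Arg (v $ l))
                      + real m / real L * (\<Sum>l = 0..<L. Arg (v $ l))
                      + 2 * pi * real k * real m / real L] (rmod (2 * pi)))
            \<longrightarrow>
            (\<exists>k' < L. \<forall>m \<in> {1..<L}.
               [\<psi> m = \<phi> m + 2 * pi * real k' * real m / real L] (rmod (2 * pi))) \<and>
            phase_circulant L X (\<lambda>m. - \<psi> m) \<in> Omega L S)"
proof -
  have "real r ^ 2 < real L"
    using r_less by (metis abs_of_nat real_sqrt_abs real_sqrt_less_iff)
  then have rL: "r\<^sup>2 < L" by (metis of_nat_less_iff of_nat_power)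
  then have L: "0 < L" by simp
  define p where "p = r\<^sup>2"
  \<comment> \<open>The main diagonal carries the fixed phase 1, so the angle at index 0 is set to 0
    whatever value \<open>\<phi> 0\<close> has.\<close>
  define \<theta> where "\<theta> = (\<lambda>m. if m = 0 then 0 else \<phi> m)"
  define \<chi> where "\<chi> = (\<lambda>m. cis (\<theta> m))"
  have X_carrier: "X \<in> carrier_mat L L" unfolding X by (rule phase_circulant_carrier[OF S_carrier])
  have X_idx: "X $$ (k, l) = S $$ (k, l) * \<chi> (sub_mod L l k)" if "k < L" "l < L" for k l
    using that by (simp add: X index_phase_circulant[OF S_carrier] \<chi>_def \<theta>_def)
  have unit: "\<chi> m * cnj (\<chi> m) = 1" for m by (simp add: \<chi>_def cis_cnj cis_mult)
  have Vt: "top_eigenvectors p (H_mat L X i i) (V i)" if "i < L" for i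
    using V that by (simp add: p_def)
  have Vc: "V i \<in> carrier_mat L p" if "i < L" for i
    using Vt[OF that] H_mat_carrier[OF X_carrier, of i i] by (simp add: top_eigenvectors_def)
  have nonzero: "size {#x \<in># proots (char_poly (H_mat L X i i)). x \<noteq> 0#} \<le> p" for i
    using nonzero_roots_H_mat_diagonal[OF S_carrier S_rank]
    by (simp add: p_def H_mat_diagonal_rephase[OF L S_carrier X_carrier X_idx unit])
  have Wc: "W \<in> carrier_mat (L * (L * L)) (L + L * (p * p))"
    unfolding W by (rule W_mat_carrier[OF Vc])
  \<comment> \<open>Shows that \<open>W\<close> has at least as many rows as columns, so that its
    singular values come from the Gram matrix acting on the domain of \<open>W\<close>.\<close>
  have "p * p < L * L" using rL by (intro mult_strict_mono) (auto simp: p_def)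
  then have "L * Suc (p * p) \<le> L * (L * L)" by (intro mult_left_mono) auto
  then have dims: "L + L * (p * p) \<le> L * (L * L)" by simp
  have kernel: "\<exists>w \<in> carrier_vec (L + L * (p * p)). W *\<^sub>v w = 0\<^sub>v (L * (L * L)) \<and>
      (\<forall>m<L. w $ m = (\<gamma> m * cnj (\<chi> m)) * cnj (\<gamma> (sub_mod L m 1) * cnj (\<chi> (sub_mod L m 1))))"
    if "T \<in> carrier_mat L L" "hermitian_mat T" "psd_mat T" "\<And>m. \<gamma> m * cnj (\<gamma> m) = 1"
      "\<And>k l. k < L \<Longrightarrow> l < L \<Longrightarrow> T $$ (k, l) = S $$ (k, l) * \<gamma> (sub_mod L l k)" for T \<gamma>
    unfolding W
  proof (rule psd_rephasing_W_kernel[OF L S_carrier X_carrier _ that(1-3)])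
    show "X $$ (k, l) = S $$ (k, l) * \<chi> (sub_mod L l k)" if "k < L" "l < L" for k l
      using that by (rule X_idx)
  qed (use that(4,5) unit Vt nonzero in auto)
  \<comment> \<open>The reference kernel vector comes from \<open>S\<close> itself. Its first
    \<open>L\<close> entries are nonzero, so it can replace the abstract generator \<open>z\<close>
    of the kernel.\<close>
  obtain s where s: "s \<in> carrier_vec (L + L * (p * p))" "W *\<^sub>v s = 0\<^sub>v (L * (L * L))"
    and s_idx': "\<forall>m<L. s $ m = (1 * cnj (\<chi> m)) * cnj (1 * cnj (\<chi> (sub_mod L m 1)))"
    using kernel[OF S_carrier S_hermitian S_psd, of "\<lambda>_. 1"] by fastforce
  have s_idx: "s $ m = cnj (\<chi> m) * \<chi> (sub_mod L m 1)" if "m < L" for m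
    using s_idx' that by simp
  have s_nz: "s $ m \<noteq> 0" if "m < L" for m
    using that by (simp add: s_idx \<chi>_def)
  then have "s \<noteq> 0\<^sub>v (L + L * (p * p))" using L by auto
  note ker = second_singular_value_kernel[OF Wc dims second_smallest s(1) this s(2)]
  then obtain z where z: "\<And>y. y \<in> carrier_vec (L + L * (p * p)) \<Longrightarrow>
      W *\<^sub>v y = 0\<^sub>v (L * (L * L)) \<Longrightarrow> \<exists>c. y = c \<cdot>\<^sub>v z" by blast
  have multiple: "\<exists>d. y = d \<cdot>\<^sub>v s"
    if y: "y \<in> carrier_vec (L + L * (p * p))" "W *\<^sub>v y = 0\<^sub>v (L * (L * L))" for y
  proof -
    obtain a b where a: "s = a \<cdot>\<^sub>v z" and b: "y = b \<cdot>\<^sub>v z" using z[OF s] z[OF y] by blast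
    have "a \<noteq> 0"
    proof
      assume "a = 0"
      moreover have "0 < dim_vec z" using a s(1) L by auto
      ultimately have "s $ 0 = 0" using a by simp
      then show False using s_nz[OF L] by blast
    qed
    then have "y = (b / a) \<cdot>\<^sub>v s" unfolding a b by (simp add: smult_smult_assoc)
    then show ?thesis ..
  qed
  have OmegaI: "T \<in> Omega L S"
    if "T \<in> carrier_mat L L" "c ^ L = 1"
      "\<And>k l. k < L \<Longrightarrow> l < L \<Longrightarrow> T $$ (k, l) = S $$ (k, l) * c ^ sub_mod L l k" for T c
    unfolding Omega_eq[OF L S_carrier]
    by (intro CollectI exI[of _ c] conjI eq_matI) (use that in auto)
  define Xt where "Xt = (\<lambda>\<psi>. phase_circulant L X (\<lambda>m. - \<psi> m))"
  \<comment> \<open>The phases of the candidate relative to \<open>S\<close>, after the removal of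
    \<open>\<psi>\<close> from \<open>X\<close>.\<close>
  define \<gamma> where "\<gamma> = (\<lambda>(\<psi> :: nat \<Rightarrow> real) m. if m = 0 then 1 else cis (\<phi> m - \<psi> m))"
  have Xt_carrier: "Xt \<psi> \<in> carrier_mat L L" for \<psi>
    unfolding Xt_def by (rule phase_circulant_carrier[OF X_carrier])
  have Xt_idx: "Xt \<psi> $$ (k, l) = S $$ (k, l) * \<gamma> \<psi> (sub_mod L l k)" if "k < L" "l < L" for \<psi> k l
    using that by (simp add: Xt_def index_phase_circulant[OF X_carrier] X_idx \<chi>_def \<theta>_def \<gamma>_def cis_mult)
  have \<gamma>_unit: "\<gamma> \<psi> m * cnj (\<gamma> \<psi> m) = 1" for \<psi> m by (simp add: \<gamma>_def cis_cnj cis_mult)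
  have "Xt \<psi> \<in> Omega L S" if psd: "hermitian_mat (Xt \<psi>)" "psd_mat (Xt \<psi>)" for \<psi>
  proof -
    obtain t where t: "t \<in> carrier_vec (L + L * (p * p))" "W *\<^sub>v t = 0\<^sub>v (L * (L * L))"
      and t_idx: "\<forall>m<L. t $ m = (\<gamma> \<psi> m * cnj (\<chi> m)) *
        cnj (\<gamma> \<psi> (sub_mod L m 1) * cnj (\<chi> (sub_mod L m 1)))"
      using kernel[OF Xt_carrier psd \<gamma>_unit Xt_idx] by blast
    obtain c where c: "t = c \<cdot>\<^sub>v s" using multiple[OF t] by blast
    \<comment> \<open>In \<open>t = c s\<close> the phases of \<open>X\<close> occur on both sides
      and cancel, leaving a constant ratio of neighbouring phases of the candidate.\<close>
    have ratio: "\<gamma> \<psi> m * cnj (\<gamma> \<psi> (sub_mod L m 1)) = c" if m: "m < L" for m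
    proof -
      have "\<gamma> \<psi> m * cnj (\<gamma> \<psi> (sub_mod L m 1)) * s $ m = c * s $ m"
      proof -
        have "\<gamma> \<psi> m * cnj (\<gamma> \<psi> (sub_mod L m 1)) * s $ m = t $ m"
          unfolding t_idx[rule_format, OF m] s_idx[OF m] by (simp add: mult_ac)
        also have "\<dots> = c * s $ m" using m s(1) by (simp add: c)
        finally show ?thesis .
      qed
      then show ?thesis using s_nz[OF m] by simp
    qed
    have "\<gamma> \<psi> 0 = 1" by (simp add: \<gamma>_def)
    note power = constant_ratio_power[OF L \<gamma>_unit this ratio]
    show ?thesis
      using power sub_mod_less[OF L] by (intro OmegaI[OF Xt_carrier, of c]) (auto simp: Xt_idx)
  qed
  then have part1: "hermitian_mat (Xt \<psi>) \<and> psd_mat (Xt \<psi>) \<longleftrightarrow> Xt \<psi> \<in> Omega L S" for \<psi>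
    using Omega_hermitian_psd[OF L S_carrier S_hermitian S_psd] by blast
  have part2: "(\<exists>k' < L. \<forall>m \<in> {1..<L}.
      [\<psi> m = \<phi> m + 2 * pi * real k' * real m / real L] (rmod (2 * pi))) \<and> Xt \<psi> \<in> Omega L S"
    if v: "right_singular_vector W (singular_values W ! 0) v"
      and \<psi>: "\<And>m. m \<in> {1..<L} \<Longrightarrow> [\<psi> m = - (\<Sum>l = 1..m. Arg (v $ l))
                      + real m / real L * (\<Sum>l = 0..<L. Arg (v $ l))
                      + 2 * pi * real k * real m / real L] (rmod (2 * pi))"
    for v k \<psi>
  proof -
    have vc: "v \<in> carrier_vec (L + L * (p * p))" and "v \<bullet>c v = 1"
      and Wv: "W *\<^sub>v v = 0\<^sub>v (L * (L * L))"
      using v Wc by (auto simp: right_singular_vector_def ker(1))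
    obtain d where d: "v = d \<cdot>\<^sub>v s" using multiple[OF vc Wv] by blast
    have "d \<noteq> 0"
    proof
      assume "d = 0"
      then have "v \<bullet>c v = 0" using s(1) by (simp add: d scalar_prod_def)
      then show False using \<open>v \<bullet>c v = 1\<close> by simp
    qed
    define \<alpha> where "\<alpha> = Arg d"
    \<comment> \<open>The smallest singular value is 0, so \<open>v\<close> is a multiple of
      \<open>s\<close>. Its arguments are backward differences of \<open>\<theta>\<close> plus a
      constant, compared under \<open>cis\<close> because \<open>Arg\<close> is a principal
      value.\<close>
    have arg: "cis (Arg (v $ l)) = cis (\<alpha> + \<theta> (sub_mod L l 1) - \<theta> l)" if l: "l < L" for l
    proof -
      have vl: "v $ l = d * cis (\<theta> (sub_mod L l 1) - \<theta> l)"
        using l s(1) by (simp add: d s_idx \<chi>_def cis_cnj cis_mult)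
      then have "v $ l \<noteq> 0" using \<open>d \<noteq> 0\<close> by simp
      then have "cis (Arg (v $ l)) = sgn (v $ l)" by (rule cis_Arg)
      also have "\<dots> = sgn d * cis (\<theta> (sub_mod L l 1) - \<theta> l)"
        unfolding vl by (simp add: sgn_mult sgn_cis)
      also have "sgn d = cis \<alpha>" unfolding \<alpha>_def by (rule cis_Arg[OF \<open>d \<noteq> 0\<close>, symmetric])
      finally show ?thesis by (simp add: cis_mult algebra_simps)
    qed
    have partial: "m < L \<Longrightarrow> cis (\<Sum>l = 1..m. Arg (v $ l)) = cis (real m * \<alpha> - \<theta> m)" for m
    proof (induction m)
      case (Suc m)
      have "cis (\<Sum>l = 1..Suc m. Arg (v $ l)) = cis (\<Sum>l = 1..m. Arg (v $ l)) * cis (Arg (v $ Suc m))"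
        by (simp add: cis_mult)
      also have "\<dots> = cis (real m * \<alpha> - \<theta> m) * cis (\<alpha> + \<theta> m - \<theta> (Suc m))"
        using Suc arg[of "Suc m"] by (simp add: sub_mod_one)
      finally show ?case by (simp add: cis_mult algebra_simps)
    qed (simp add: \<theta>_def)
    \<comment> \<open>Around the whole cycle the differences cancel, so the total is
      \<open>L * \<alpha>\<close> modulo \<open>2 * pi\<close>. The integer \<open>n\<close> records
      the multiple, which must be kept because the formula divides the sum by
      \<open>L\<close>.\<close>
    have "{0..<L} = insert 0 {1..L - 1}" using L by auto
    then have "cis (\<Sum>l = 0..<L. Arg (v $ l)) = cis (Arg (v $ 0)) * cis (\<Sum>l = 1..L - 1. Arg (v $ l))"
      by (simp add: cis_mult)
    also have "\<dots> = cis (\<alpha> + \<theta> (L - 1) - \<theta> 0) * cis (real (L - 1) * \<alpha> - \<theta> (L - 1))"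
      using arg[OF L] partial[of "L - 1"] L by (simp add: sub_mod_one)
    also have "\<dots> = cis (real L * \<alpha>)" using L by (simp add: cis_mult \<theta>_def of_nat_diff algebra_simps)
    finally obtain n where n: "(\<Sum>l = 0..<L. Arg (v $ l)) = real L * \<alpha> + of_int n * (2 * pi)"
      unfolding cis_eq_iff using rcong_altdef rcong_sym by metis
    \<comment> \<open>The ambiguity \<open>n\<close> contributes the angle
      \<open>2 * pi * n * m / L\<close> and merges with \<open>k\<close>; multiples of
      \<open>L\<close> in \<open>n + k\<close> give full turns.\<close>
    define k' where "k' = nat ((n + int k) mod int L)"
    have k': "k' < L" using L by (simp add: k'_def nat_less_iff)
    have "n + int k = int L * ((n + int k) div int L) + int k'" using L by (simp add: k'_def)
    then have nk: "of_int n + real k = real L * of_int ((n + int k) div int L) + real k'"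
      by (metis of_int_add of_int_mult of_int_of_nat_eq)
    have \<psi>': "[\<psi> m = \<phi> m + 2 * pi * real k' * real m / real L] (rmod (2 * pi))" if m: "m \<in> {1..<L}" for m
    proof -
      have "cis (\<psi> m) = cis (- (\<Sum>l = 1..m. Arg (v $ l))
          + real m / real L * (real L * \<alpha> + of_int n * (2 * pi)) + 2 * pi * real k * real m / real L)"
        using \<psi>[OF m] unfolding cis_eq_iff n .
      also have "\<dots> = cnj (cis (\<Sum>l = 1..m. Arg (v $ l))) *
          cis (real m * \<alpha> + (of_int n + real k) * (2 * pi * real m / real L))"
        using L by (simp add: cis_cnj cis_mult field_simps)
      also have "\<dots> = cis (\<theta> m + (of_int n + real k) * (2 * pi * real m / real L))"
        using partial[of m] m by (simp add: cis_cnj cis_mult algebra_simps)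
      also have "(of_int n + real k) * (2 * pi * real m / real L) =
          of_int ((n + int k) div int L * int m) * (2 * pi) + 2 * pi * real k' * real m / real L"
        unfolding nk using L by (simp add: field_simps)
      also have "cis (\<theta> m + (of_int ((n + int k) div int L * int m) * (2 * pi)
            + 2 * pi * real k' * real m / real L)) =
          cis (\<phi> m + 2 * pi * real k' * real m / real L)"
        unfolding cis_eq_iff rcong_altdef
        by (rule exI[of _ "- ((n + int k) div int L * int m)"])
          (use m in \<open>simp add: \<theta>_def algebra_simps\<close>)
      finally show ?thesis unfolding cis_eq_iff .
    qed
    \<comment> \<open>The conjugate appears because the candidate carries
      \<open>\<phi> - \<psi>\<close>, the negative of the excess of \<open>\<psi>\<close> over
      \<open>\<phi>\<close>.\<close>
    define c where "c = cnj (cis (2 * pi * real k' / real L))"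
    have c_pow: "\<gamma> \<psi> m = c ^ m" if "m < L" for m
    proof (cases "m = 0")
      case False
      have "\<gamma> \<psi> m = cis (\<phi> m) * cnj (cis (\<psi> m))"
        using False by (simp add: \<gamma>_def cis_cnj cis_mult)
      also have "cis (\<psi> m) = cis (\<phi> m + 2 * pi * real k' * real m / real L)"
        unfolding cis_eq_iff using \<psi>' False that by auto
      also have "cis (\<phi> m) * cnj \<dots> = c ^ m"
        unfolding c_def by (simp add: cis_cnj cis_mult DeMoivre mult_ac)
      finally show ?thesis .
    qed (simp add: \<gamma>_def)
    have "c ^ L = 1" unfolding c_def using cis_root_of_unity[OF L, of k'] by (simp flip: complex_cnj_power)
    then have "Xt \<psi> \<in> Omega L S"
      using sub_mod_less[OF L] by (intro OmegaI[OF Xt_carrier, of c]) (auto simp: Xt_idx c_pow)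
    then show ?thesis using \<psi>' k' by blast
  qed
  show ?thesis
    using part1 part2 unfolding Xt_def Let_def by blast
qed

end
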